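(* Let $E,F$ be complex Banach spaces, $U$ an open subset of $E$, $1<p\leq\infty$ and $f\in\mathcal{H}^\infty(U,F)$. The following conditions are equivalent: (i) $f$ is Cohen strongly $p$-summing holomorphic. (ii) For any $\sum_{i=1}^n\lambda_i\delta(x_i)\otimes y_i^*\in\Delta(U)\otimes F^*$, we have $$\left|\sum_{i=1}^n\lambda_i\langle y_i^*,f(x_i)\rangle\right|\leq d_p^{\mathcal{H}^\infty}(f)\,\|(\lambda_1,\dots,\lambda_n)\|_{\ell_p^n}\,\|(y_1^*,\dots,y_n^* )\|_{\ell_{p^*}^{n,w}(F^* )}.$$ (iii) There is a constant $C>0$ and a Borel regular probability measure $\mu$ on $B_{F^{**}}$ such that $$|\langle y^*,f(x)\rangle|\leq C\|y^*\|_{L_{p^*}(\mu)}$$ for all $x\in U$ and $y^*\in F^*$, where $$\|y^*\|_{L_{p^*}(\mu)}=\left(\int_{B_{F^{**}}}|y^{**}(y^* )|^{p^*}\,d\mu(y^{**})\right)^{\frac{1}{p^*}}.$$ In this case, $d_p^{\mathcal{H}^\infty}(f)$ is the minimum of all constants $C>0$ satisfying the preceding inequality.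
   Context: $\mathcal{H}^\infty(U,F)$ is the Banach space of all bounded holomorphic mappings from $U$ to $F$ with the supremum norm. $B_X$ is the closed unit ball of a Banach space $X$ (with $B_{F^{**}}$ carrying the weak* topology when measures on it are considered), and $p^*$ is the conjugate index of $p$ (with $p^*=1$ if $p=\infty$). For $x\in U$ and $y^*\in F^*$, $\delta(x)\otimes y^*$ is the linear functional on $\mathcal{H}^\infty(U,F^{**})$ given by $(\delta(x)\otimes y^* )(h)=\langle h(x),y^*\rangle$, and $\Delta(U)\otimes F^*$ is the linear span of these functionals; thus the expressions in (ii) range over all $n\in\mathbb{N}$, $\lambda_i\in\mathbb{C}$, $x_i\in U$, $y_i^*\in F^*$. Write $\|(\lambda_1,\dots,\lambda_n)\|_{\ell_p^n}=(\sum_{i=1}^n|\lambda_i|^p)^{1/p}$ if $p<\infty$ and $\max_{1\le i\le n}|\lambda_i|$ if $p=\infty$, and $\|(y_1^*,\dots,y_n^* )\|_{\ell_{p^*}^{n,w}(F^* )}=\sup_{y^{**}\in B_{F^{**}}}(\sum_{i=1}^n|y^{**}(y_i^* )|^{p^*})^{1/p^*}$. A holomorphic mapping $f\colon U\to F$ is Cohen strongly $p$-summing if there is a constant $C\geq0$ such that for all $n\in\mathbb{N}$, $\lambda_1,\dots,\lambda_n\in\mathbb{C}$, $x_1,\dots,x_n\in U$ and $y_1^*,\dots,y_n^*\in F^*$, $$\sum_{i=1}^n|\lambda_i||\langle y_i^*,f(x_i)\rangle|\leq C\,\|(\lambda_1,\dots,\lambda_n)\|_{\ell_p^n}\,\|(y_1^*,\dots,y_n^*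 )\|_{\ell_{p^*}^{n,w}(F^* )};$$ $d_p^{\mathcal{H}^\infty}(f)$ denotes the infimum of such constants $C$.
   Formalization: The final claim is false if f vanishes on U (then d_p(f)=0 and the constants C>0 have no minimum); it is stated as: d_p(f) is the minimum of all such C≥0, and the minimum of all such C>0 when f is not identically zero on U. *)

theory Defs
  imports "HOL-Analysis.Analysis" "HOL-Probability.Probability_Measure"
begin

section \<open>Complex normed spaces and complex Banach spaces\<close>

class complex_normed_vector = real_normed_vector +
  fixes scaleC :: "complex \<Rightarrow> 'a \<Rightarrow> 'a"  (infixr \<open>*\<^sub>C\<close> 75)
  assumes scaleC_add_right: "a *\<^sub>C (x + y) = a *\<^sub>C x + a *\<^sub>C y"
    and scaleC_add_left: "(a + b) *\<^sub>C x = a *\<^sub>C x + b *\<^sub>C x"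
    and scaleC_scaleC: "a *\<^sub>C (b *\<^sub>C x) = (a * b) *\<^sub>C x"
    and scaleC_of_real: "complex_of_real r *\<^sub>C x = r *\<^sub>R x"
    and norm_scaleC: "norm (a *\<^sub>C x) = cmod a * norm x"

class complex_banach = complex_normed_vector + banach

instantiation complex :: complex_banach
begin

definition scaleC_complex :: "complex \<Rightarrow> complex \<Rightarrow> complex"
  where "scaleC_complex a z = a * z"

instance
  by standard (simp_all add: scaleC_complex_def algebra_simps norm_mult scaleR_conv_of_real)

end

definition bounded_clinear ::
  "('a::complex_normed_vector \<Rightarrow> 'b::complex_normed_vector) \<Rightarrow> bool"
  where "bounded_clinear g \<longleftrightarrow> bounded_linear g \<and> (\<forall>c x. g (c *\<^sub>C x) = c *\<^sub>C g x)"


section \<open>The dual space\<close>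

text \<open>
  The type \<open>'a cdual\<close> is the space of bounded complex-linear functionals on \<open>'a\<close> with the
  operator norm, so that \<open>'a cdual cdual\<close> is the bidual.
\<close>

typedef (overloaded) 'a cdual =
  "{g :: 'a::complex_normed_vector \<Rightarrow> complex. bounded_clinear g}"
  morphisms cdual_apply Cdual
  by (rule exI[of _ "\<lambda>_. 0"]) (simp add: bounded_clinear_def scaleC_complex_def)

setup_lifting type_definition_cdual

instantiation cdual :: (complex_normed_vector) complex_normed_vector
begin

lift_definition norm_cdual :: "'a cdual \<Rightarrow> real" is onorm .

lift_definition minus_cdual :: "'a cdual \<Rightarrow> 'a cdual \<Rightarrow> 'a cdual"
  is "\<lambda>g h x. g x - h x"
  by (simp add: bounded_clinear_def scaleC_complex_def bounded_linear_sub algebra_simps)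

definition dist_cdual :: "'a cdual \<Rightarrow> 'a cdual \<Rightarrow> real"
  where "dist_cdual a b = norm (a - b)"

definition uniformity_cdual :: "('a cdual \<times> 'a cdual) filter"
  where "uniformity_cdual = (INF e\<in>{0 <..}. principal {(x, y). dist x y < e})"

definition open_cdual :: "'a cdual set \<Rightarrow> bool"
  where "open_cdual S = (\<forall>x\<in>S. \<forall>\<^sub>F (x', y) in uniformity. x' = x \<longrightarrow> y \<in> S)"

lift_definition uminus_cdual :: "'a cdual \<Rightarrow> 'a cdual" is "\<lambda>g x. - g x"
  by (simp add: bounded_clinear_def scaleC_complex_def bounded_linear_minus)

lift_definition zero_cdual :: "'a cdual" is "\<lambda>x. 0"
  by (simp add: bounded_clinear_def scaleC_complex_def)

lift_definition plus_cdual :: "'a cdual \<Rightarrow> 'a cdual \<Rightarrow> 'a cdual"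
  is "\<lambda>g h x. g x + h x"
  by (simp add: bounded_clinear_def scaleC_complex_def bounded_linear_add algebra_simps)

lift_definition scaleR_cdual :: "real \<Rightarrow> 'a cdual \<Rightarrow> 'a cdual" is "\<lambda>r g x. r *\<^sub>R g x"
  by (simp add: bounded_clinear_def scaleC_complex_def bounded_linear_const_scaleR)

lift_definition scaleC_cdual :: "complex \<Rightarrow> 'a cdual \<Rightarrow> 'a cdual" is "\<lambda>c g x. c * g x"
  by (simp add: bounded_clinear_def scaleC_complex_def bounded_linear_const_mult)

definition sgn_cdual :: "'a cdual \<Rightarrow> 'a cdual"
  where "sgn_cdual x = inverse (norm x) *\<^sub>R x"

instance
proof
  fix a b :: complex and r s :: real and x y z :: "'a cdual"
  show "x + y + z = x + (y + z)" "x + y = y + x" "0 + x = x" "- x + x = 0" "x - y = x + - y"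
    "r *\<^sub>R (x + y) = r *\<^sub>R x + r *\<^sub>R y" "(r + s) *\<^sub>R x = r *\<^sub>R x + s *\<^sub>R x"
    "r *\<^sub>R s *\<^sub>R x = (r * s) *\<^sub>R x" "1 *\<^sub>R x = x"
    "a *\<^sub>C (x + y) = a *\<^sub>C x + a *\<^sub>C y" "(a + b) *\<^sub>C x = a *\<^sub>C x + b *\<^sub>C x"
    "a *\<^sub>C (b *\<^sub>C x) = (a * b) *\<^sub>C x"
    by (transfer; simp add: fun_eq_iff algebra_simps)+
  show "complex_of_real r *\<^sub>C x = r *\<^sub>R x"
    by transfer (simp add: scaleR_conv_of_real)
  show "norm (r *\<^sub>R x) = \<bar>r\<bar> * norm x"
    by transfer (simp add: onorm_scaleR bounded_clinear_def)
  show "(norm x = 0) = (x = 0)"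
    by transfer (auto simp: onorm_eq_0 bounded_clinear_def fun_eq_iff)
  show "norm (x + y) \<le> norm x + norm y"
    by transfer (simp add: onorm_triangle bounded_clinear_def)
  show "norm (a *\<^sub>C x) = cmod a * norm x"
  proof (transfer fixing: a)
    fix g :: "'a \<Rightarrow> complex"
    assume g: "bounded_clinear g"
    have "onorm (\<lambda>x. a * g x) = onorm (\<lambda>x. cmod a *\<^sub>R g x)"
      unfolding onorm_def by (simp add: norm_mult)
    then show "onorm (\<lambda>x. a * g x) = cmod a * onorm g"
      using g by (simp add: onorm_scaleR bounded_clinear_def)
  qed
  show "dist x y = norm (x - y)" by (rule dist_cdual_def)
  show "sgn x = inverse (norm x) *\<^sub>R x" by (rule sgn_cdual_def)
  show "(uniformity :: ('a cdual \<times> 'a cdual) filter) =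
      (INF e\<in>{0 <..}. principal {(x, y). dist x y < e})"
    by (rule uniformity_cdual_def)
  show "open S = (\<forall>x\<in>S. \<forall>\<^sub>F (x', y) in uniformity. x' = x \<longrightarrow> y \<in> S)" for S :: "'a cdual set"
    by (rule open_cdual_def)
qed

end


section \<open>Measures on the closed unit ball of the bidual\<close>

text \<open>
  The weak* topology on a dual space is the coarsest one making all evaluations continuous.
\<close>

definition weak_star :: "'a::complex_normed_vector cdual topology"
  where "weak_star = topology_generated_by {{g. cdual_apply g x \<in> V} |x V. open V}"

definition bidual_ball :: "'a::complex_normed_vector cdual cdual topology"
  where "bidual_ball = subtopology weak_star (cball 0 1)"

definition borel_regular_prob :: "'a topology \<Rightarrow> 'a measure \<Rightarrow> bool"
  where "borel_regular_prob X M \<longleftrightarrow>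
    prob_space M \<and>
    sets M = sets (sigma (topspace X) {V. openin X V}) \<and>
    (\<forall>A\<in>sets M. emeasure M A = (INF V\<in>{V. openin X V \<and> A \<subseteq> V}. emeasure M V)) \<and>
    (\<forall>A\<in>sets M. emeasure M A = (SUP K\<in>{K. compactin X K \<and> K \<subseteq> A}. emeasure M K))"


section \<open>Norms\<close>

text \<open>
  Exponents are extended reals.  For \<open>1 < p \<le> \<infinity>\<close> the conjugate index is a real number in
  \<open>[1, \<infinity>)\<close>.
\<close>

definition conj_index :: "ereal \<Rightarrow> real"
  where "conj_index p = (if p = \<infinity> then 1 else real_of_ereal p / (real_of_ereal p - 1))"

text \<open>
  Tuples are indexed by \<open>{1..n}\<close>; the maximum below requires \<open>n > 0\<close>.
\<close>

definition lp_norm :: "ereal \<Rightarrow> nat \<Rightarrow> (nat \<Rightarrow> complex) \<Rightarrow> real"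
  where "lp_norm p n l =
    (if p = \<infinity> then Max ((\<lambda>i. cmod (l i)) ` {1..n})
     else (\<Sum>i=1..n. cmod (l i) powr real_of_ereal p) powr (1 / real_of_ereal p))"

definition weak_lq_norm ::
  "real \<Rightarrow> nat \<Rightarrow> (nat \<Rightarrow> 'f::complex_normed_vector cdual) \<Rightarrow> real"
  where "weak_lq_norm q n y =
    (SUP z \<in> cball (0 :: 'f cdual cdual) 1.
       (\<Sum>i=1..n. cmod (cdual_apply z (y i)) powr q) powr (1 / q))"

definition Lq_norm ::
  "real \<Rightarrow> 'f::complex_normed_vector cdual cdual measure \<Rightarrow> 'f cdual \<Rightarrow> real"
  where "Lq_norm q \<mu> y = (LINT z|\<mu>. cmod (cdual_apply z y) powr q) powr (1 / q)"


section \<open>Holomorphic and Cohen strongly summing mappings\<close>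

text \<open>
  Holomorphy on an open set is complex Frechet differentiability at each of its points.
  Mappings on \<open>U\<close> are total functions whose values outside \<open>U\<close> are irrelevant.
\<close>

definition holomorphic_map ::
  "'e::complex_normed_vector set \<Rightarrow> ('e \<Rightarrow> 'f::complex_normed_vector) \<Rightarrow> bool"
  where "holomorphic_map U f \<longleftrightarrow>
    (\<forall>x\<in>U. \<exists>D. bounded_clinear D \<and> (f has_derivative D) (at x))"

definition H_infinity ::
  "'e::complex_normed_vector set \<Rightarrow> ('e \<Rightarrow> 'f::complex_normed_vector) set"
  where "H_infinity U = {f. holomorphic_map U f \<and> bounded (f ` U)}"

definition cohen_constants ::
  "ereal \<Rightarrow> 'e set \<Rightarrow> ('e \<Rightarrow> 'f::complex_normed_vector) \<Rightarrow> real set"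
  where "cohen_constants p U f = {C. 0 \<le> C \<and>
    (\<forall>(n::nat) l x y. 0 < n \<longrightarrow> (\<forall>i\<in>{1..n}. x i \<in> U) \<longrightarrow>
       (\<Sum>i=1..n. cmod (l i) * cmod (cdual_apply (y i) (f (x i))))
         \<le> C * lp_norm p n l * weak_lq_norm (conj_index p) n y)}"

definition cohen_strongly_summing ::
  "ereal \<Rightarrow> 'e::complex_normed_vector set \<Rightarrow> ('e \<Rightarrow> 'f::complex_normed_vector) \<Rightarrow> bool"
  where "cohen_strongly_summing p U f \<longleftrightarrow>
    holomorphic_map U f \<and> cohen_constants p U f \<noteq> {}"

text \<open>
  The infimum is a real one, so it is meaningful only if \<open>cohen_constants p U f\<close> is nonempty.
\<close>

definition cohen_norm ::
  "ereal \<Rightarrow> 'e set \<Rightarrow> ('e \<Rightarrow> 'f::complex_normed_vector) \<Rightarrow> real"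
  where "cohen_norm p U f = Inf (cohen_constants p U f)"

definition dominated_by ::
  "ereal \<Rightarrow> 'e set \<Rightarrow> ('e \<Rightarrow> 'f::complex_normed_vector) \<Rightarrow> real \<Rightarrow> 'f cdual cdual measure \<Rightarrow> bool"
  where "dominated_by p U f C \<mu> \<longleftrightarrow>
    (\<forall>x\<in>U. \<forall>y. cmod (cdual_apply y (f x)) \<le> C * Lq_norm (conj_index p) \<mu> y)"

definition is_minimum :: "real \<Rightarrow> real set \<Rightarrow> bool"
  where "is_minimum m S \<longleftrightarrow> m \<in> S \<and> (\<forall>c\<in>S. m \<le> c)"

end

theory Submission
  imports Defs "HOL-Probability.Discrete_Topology"
begin

text \<open>
  Write \<open>q\<close> for the conjugate index of \<open>p\<close>. By the duality between \<open>\<ell>\<^sub>p\<close> and \<open>\<ell>\<^sub>q\<close>, a constant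
  \<open>C\<close> satisfies the Cohen inequality if and only if
  \<open>\<Sum>\<bar>y\<^sub>i (f x\<^sub>i)\<bar>\<^sup>q \<le> C\<^sup>q sup\<^sub>z \<Sum>\<bar>z y\<^sub>i\<bar>\<^sup>q\<close> for all finite families, where \<open>z\<close> runs through the
  unit ball of the bidual. Replacing the supremum by the integral against a probability measure
  makes the right-hand side additive in the family, so domination is the same inequality for single
  pairs \<open>(x, y)\<close>. The equivalence is thus Pietsch's domination theorem, and it holds with the same
  constant: the Cohen constants are exactly the constants \<open>C \<ge> 0\<close> of domination
  (\<open>cohen_constants_eq_dominated\<close>). One direction is Hoelder's inequality
  (\<open>dominated_imp_cohen_constant\<close>).
  
  For the other direction (\<open>cohen_constant_imp_dominated\<close>), the functions
  \<open>z \<mapsto> C\<^sup>q \<bar>z y\<bar>\<^sup>q - \<bar>y (f x)\<bar>\<^sup>q\<close> generate a convex cone of continuous functions none of which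
  has a negative supremum. A Hahn-Banach theorem for cones (\<open>Mazur_Orlicz_cone\<close>) gives a finitely
  additive probability whose integral is nonnegative on the cone. The ball is weak* compact and
  Hausdorff (\<open>Banach_Alaoglu\<close>, \<open>Hausdorff_dual_ball\<close>), so the values of this probability on closed
  sets generate a regular Borel measure (locale \<open>closed_content\<close>), whose integrals of continuous
  functions dominate those of the mean (\<open>regular_prob_nonneg_on_cone\<close>).
  
  The set of Cohen constants contains its infimum (\<open>cohen_norm_mem\<close>), which gives the minimum. That
  the minimum is positive when \<open>f\<close> is nonzero somewhere on \<open>U\<close> uses that functionals separate points
  (\<open>cdual_separates_points\<close>). The inequality with the modulus outside the sum is equivalent to the
  Cohen inequality because the phases of the weights are free.
\<close>

section \<open>Sublinear functionals\<close>

definition sublinear :: "('a::real_vector \<Rightarrow> real) \<Rightarrow> bool"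
  where "sublinear q \<longleftrightarrow> (\<forall>x y. q (x + y) \<le> q x + q y) \<and> (\<forall>r x. 0 \<le> r \<longrightarrow> q (r *\<^sub>R x) = r * q x)"

text \<open>
  An inequality for positive scalars suffices: applied to \<open>r\<close> and to \<open>1 / r\<close> it becomes an equality.
\<close>
lemma sublinearI:
  assumes "\<And>x y. q (x + y) \<le> q x + q y"
    and "\<And>r x. 0 < r \<Longrightarrow> q (r *\<^sub>R x) \<le> r * q x"
    and "q 0 = 0"
  shows "sublinear q"
proof -
  have "q (r *\<^sub>R x) = r * q x" if "0 \<le> r" for r x
  proof (cases "r = 0")
    case False
    with that have r: "0 < r" by simp
    have "q x = q (inverse r *\<^sub>R (r *\<^sub>R x))" using r by simp
    also have "\<dots> \<le> inverse r * q (r *\<^sub>R x)" using r by (intro assms(2)) simp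
    finally have "r * q x \<le> q (r *\<^sub>R x)" using r by (simp add: field_simps)
    with assms(2)[OF r, of x] show ?thesis by simp
  qed (use assms(3) in simp)
  with assms(1) show ?thesis by (auto simp: sublinear_def)
qed

lemma sublinear_add: "sublinear q \<Longrightarrow> q (x + y) \<le> q x + q y"
  and sublinear_scaleR: "sublinear q \<Longrightarrow> 0 \<le> r \<Longrightarrow> q (r *\<^sub>R x) = r * q x"
  by (auto simp: sublinear_def)

lemma sublinear_zero: "sublinear q \<Longrightarrow> q 0 = 0"
  using sublinear_scaleR[of q 0 0] by simp

lemma sublinear_minus: "sublinear q \<Longrightarrow> - q (- x) \<le> q x"
  using sublinear_add[of q x "- x"] sublinear_zero[of q] by simp

text \<open>
  Lowering a sublinear functional so that it becomes at most \<open>- c g\<close> at \<open>- g\<close> for every \<open>g\<close> in a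
  cone. Any linear functional below the lowered one is then at least \<open>c g\<close> at \<open>g\<close>. The condition
  \<open>c g \<le> p g\<close> is what keeps the infimum finite: it gives the lower bound \<open>- p (- x)\<close>.
\<close>
lemma sublinear_Inf_cone:
  fixes p c :: "'a::real_vector \<Rightarrow> real"
  assumes p: "sublinear p"
    and Q0: "0 \<in> Q" and Qadd: "\<And>g h. g \<in> Q \<Longrightarrow> h \<in> Q \<Longrightarrow> g + h \<in> Q"
    and Qscale: "\<And>g r. g \<in> Q \<Longrightarrow> 0 < r \<Longrightarrow> r *\<^sub>R g \<in> Q"
    and cadd: "\<And>g h. g \<in> Q \<Longrightarrow> h \<in> Q \<Longrightarrow> c g + c h \<le> c (g + h)"
    and cscale: "\<And>g r. g \<in> Q \<Longrightarrow> 0 < r \<Longrightarrow> c (r *\<^sub>R g) = r * c g"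
    and c_le: "\<And>g. g \<in> Q \<Longrightarrow> c g \<le> p g"
  defines "P \<equiv> \<lambda>x. INF g\<in>Q. p (x + g) - c g"
  shows "sublinear P" and "\<And>x g. g \<in> Q \<Longrightarrow> P x \<le> p (x + g) - c g" and "\<And>x. P x \<le> p x"
proof -
  have low: "- p (- x) \<le> p (x + g) - c g" if "g \<in> Q" for x g
    using sublinear_add[OF p, of "- x" "x + g"] c_le[OF that] by simp
  have bdd: "bdd_below ((\<lambda>g. p (x + g) - c g) ` Q)" for x
    using low by (intro bdd_belowI2[where m = "- p (- x)"])
  show upper: "P x \<le> p (x + g) - c g" if "g \<in> Q" for x g
    unfolding P_def using that bdd by (intro cINF_lower)
  have c0: "c 0 = 0"
    using cscale[OF Q0, of 2] by simp
  show "P x \<le> p x" for x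
    using upper[OF Q0, of x] c0 by simp
  have P_ge: "b \<le> P x" if "\<And>g. g \<in> Q \<Longrightarrow> b \<le> p (x + g) - c g" for b x
    unfolding P_def using Q0 that by (intro cINF_greatest) auto
  show "sublinear P"
  proof (rule sublinearI)
    fix x y
    have split: "P (x + y) - (p (x + g) - c g) \<le> p (y + h) - c h" if "g \<in> Q" "h \<in> Q" for g h
      using upper[OF Qadd[OF that], of "x + y"] cadd[OF that] sublinear_add[OF p, of "x + g" "y + h"]
      by (simp add: algebra_simps)
    have "P (x + y) - P y \<le> p (x + g) - c g" if "g \<in> Q" for g
    proof -
      have "P (x + y) - (p (x + g) - c g) \<le> P y"
        using that by (intro P_ge) (rule split)
      then show ?thesis by linarith
    qed
    then have "P (x + y) - P y \<le> P x" by (rule P_ge)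
    then show "P (x + y) \<le> P x + P y" by linarith
  next
    fix r :: real and x assume r: "0 < r"
    have "P (r *\<^sub>R x) / r \<le> p (x + g) - c g" if "g \<in> Q" for g
      using upper[OF Qscale[OF that r], of "r *\<^sub>R x"] cscale[OF that r] r
        sublinear_scaleR[OF p, of r "x + g"]
      by (simp add: field_simps scaleR_add_right)
    then have "P (r *\<^sub>R x) / r \<le> P x" by (rule P_ge)
    then show "P (r *\<^sub>R x) \<le> r * P x" using r by (simp add: field_simps)
  next
    have "0 \<le> P 0" using c_le by (intro P_ge) simp
    with upper[OF Q0, of 0] c0 sublinear_zero[OF p] show "P 0 = 0" by simp
  qed
qed

text \<open>
  Zorn's lemma applies because the pointwise infimum of a chain of sublinear functionals below \<open>p\<close>
  is again sublinear; it is finite because each member \<open>q\<close> satisfies \<open>- p (- x) \<le> q x\<close>.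
\<close>
lemma sublinear_minorant_minimal:
  fixes p :: "'a::real_vector \<Rightarrow> real"
  assumes p: "sublinear p"
  obtains q where "sublinear q" "q \<le> p" "\<And>q'. sublinear q' \<Longrightarrow> q' \<le> q \<Longrightarrow> q' = q"
proof -
  define A where "A = {q. sublinear q \<and> q \<le> p}"
  have po: "partial_order_on A (relation_of (\<ge>) A)"
    by (rule partial_order_on_relation_ofI) auto
  have "\<exists>u\<in>A. \<forall>q\<in>K. u \<le> q" if K: "K \<in> Chains (relation_of (\<ge>) A)" for K
  proof (cases "K = {}")
    case True
    with p show ?thesis by (auto simp: A_def)
  next
    case False
    have "q \<in> A" if "q \<in> K" for q
      using K that by (auto simp: Chains_def relation_of_def)
    then have K_sub: "sublinear q" "q x \<le> p x" if "q \<in> K" for q x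
      using that by (auto simp: A_def le_fun_def)
    have K_total: "q \<le> q' \<or> q' \<le> q" if "q \<in> K" "q' \<in> K" for q q'
      using K that by (auto simp: Chains_def relation_of_def)
    define u where "u = (\<lambda>x. INF q\<in>K. q x)"
    have low: "- p (- x) \<le> q x" if "q \<in> K" for q x
      using sublinear_minus[OF K_sub(1)[OF that], of x] K_sub(2)[OF that, of "- x"] by simp
    have upper: "u x \<le> q x" if "q \<in> K" for q x
      unfolding u_def using that low by (intro cINF_lower bdd_belowI2[where m = "- p (- x)"])
    have u_ge: "b \<le> u x" if "\<And>q. q \<in> K \<Longrightarrow> b \<le> q x" for b x
      unfolding u_def using False that by (intro cINF_greatest)
    have "sublinear u"
    proof (rule sublinearI)
      fix x y
      \<comment> \<open>Of two members of the chain, the smaller one is used at both points.\<close>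
      have split: "u (x + y) - q x \<le> q' y" if qq: "q \<in> K" "q' \<in> K" for q q'
        using K_total[OF qq]
      proof
        assume "q \<le> q'"
        then have "q y \<le> q' y" by (simp add: le_fun_def)
        with upper[OF qq(1), of "x + y"] sublinear_add[OF K_sub(1)[OF qq(1)], of x y]
        show ?thesis by simp
      next
        assume "q' \<le> q"
        then have "q' x \<le> q x" by (simp add: le_fun_def)
        with upper[OF qq(2), of "x + y"] sublinear_add[OF K_sub(1)[OF qq(2)], of x y]
        show ?thesis by simp
      qed
      have "u (x + y) - u y \<le> q x" if "q \<in> K" for q
      proof -
        have "u (x + y) - q x \<le> u y"
          using that by (intro u_ge) (rule split)
        then show ?thesis by linarith
      qed
      then have "u (x + y) - u y \<le> u x" by (rule u_ge)
      then show "u (x + y) \<le> u x + u y" by linarith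
    next
      fix r :: real and x assume r: "0 < r"
      have "u (r *\<^sub>R x) / r \<le> q x" if "q \<in> K" for q
        using upper[OF that, of "r *\<^sub>R x"] sublinear_scaleR[OF K_sub(1)[OF that], of r x] r
        by (simp add: field_simps)
      then show "u (r *\<^sub>R x) \<le> r * u x"
        using u_ge[of "u (r *\<^sub>R x) / r" x] r by (simp add: field_simps)
    next
      from False obtain q where "q \<in> K" by blast
      then have "u 0 \<le> 0" using upper[of q 0] sublinear_zero[OF K_sub(1)[of q]] by simp
      moreover have "0 \<le> u 0" by (rule u_ge) (simp add: sublinear_zero[OF K_sub(1)])
      ultimately show "u 0 = 0" by simp
    qed
    moreover have "u \<le> p"
      using False upper K_sub(2) unfolding le_fun_def by (meson all_not_in_conv order_trans)
    ultimately show ?thesis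
      using upper by (auto simp: A_def le_fun_def)
  qed
  from predicate_Zorn[OF po this] obtain q where q: "q \<in> A" "\<forall>q'\<in>A. q \<ge> q' \<longrightarrow> q' = q"
    by blast
  show thesis
  proof (rule that)
    show "q' = q" if "sublinear q'" "q' \<le> q" for q'
      using q that by (auto simp: A_def)
  qed (use q in \<open>auto simp: A_def\<close>)
qed

text \<open>
  The Mazur-Orlicz form of the Hahn-Banach theorem. A minimal sublinear functional \<open>L\<close> is linear:
  lowering it along the ray through \<open>y\<close> cannot change it, which says
  \<open>L x + L y \<le> L (x + y)\<close>. This avoids extending functionals from subspaces. With \<open>c = 0\<close> the theorem
  yields positive functionals, and with \<open>c = norm\<close> on a ray it yields norming functionals.
\<close>
theorem Mazur_Orlicz_cone:
  fixes p c :: "'a::real_vector \<Rightarrow> real"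
  assumes p: "sublinear p"
    and Q0: "0 \<in> Q" and Qadd: "\<And>g h. g \<in> Q \<Longrightarrow> h \<in> Q \<Longrightarrow> g + h \<in> Q"
    and Qscale: "\<And>g r. g \<in> Q \<Longrightarrow> 0 < r \<Longrightarrow> r *\<^sub>R g \<in> Q"
    and cadd: "\<And>g h. g \<in> Q \<Longrightarrow> h \<in> Q \<Longrightarrow> c g + c h \<le> c (g + h)"
    and cscale: "\<And>g r. g \<in> Q \<Longrightarrow> 0 < r \<Longrightarrow> c (r *\<^sub>R g) = r * c g"
    and c_le: "\<And>g. g \<in> Q \<Longrightarrow> c g \<le> p g"
  obtains L where "linear L" "\<And>x. L x \<le> p x" "\<And>g. g \<in> Q \<Longrightarrow> c g \<le> L g"
proof -
  define P where "P = (\<lambda>x. INF g\<in>Q. p (x + g) - c g)"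
  have P: "sublinear P" "\<And>x g. g \<in> Q \<Longrightarrow> P x \<le> p (x + g) - c g" "\<And>x. P x \<le> p x"
    unfolding P_def
    using sublinear_Inf_cone[where p = p and Q = Q and c = c, OF assms] by blast+
  from sublinear_minorant_minimal[OF P(1)] obtain L
    where L: "sublinear L" "L \<le> P" and min: "\<And>q. sublinear q \<Longrightarrow> q \<le> L \<Longrightarrow> q = L"
    by blast
  have add: "L (x + y) = L x + L y" for x y
  proof (rule antisym)
    define R where "R = {t *\<^sub>R y |t. 0 \<le> t}"
    define N where "N = (\<lambda>x. INF g\<in>R. L (x + g) - L g)"
    have scale: "L (r *\<^sub>R z) = r * L z" if "0 \<le> r" for r z
      using sublinear_scaleR[OF L(1) that] .
    have R: "0 \<in> R" "y \<in> R"
      unfolding R_def by (auto intro: exI[of _ 0] exI[of _ 1])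
    have R_add: "g + h \<in> R" if "g \<in> R" "h \<in> R" for g h
      using that by (auto simp: R_def simp flip: scaleR_add_left)
    have R_scale: "r *\<^sub>R g \<in> R" if "g \<in> R" "0 < r" for g r
      using that unfolding R_def by (force intro: mult_nonneg_nonneg)
    have L_R: "L g + L h \<le> L (g + h)" if "g \<in> R" "h \<in> R" for g h
      using that by (auto simp: R_def scale algebra_simps simp flip: scaleR_add_left)
    have "sublinear N" "N x \<le> L (x + y) - L y" "\<And>x. N x \<le> L x"
      unfolding N_def
      by (rule sublinear_Inf_cone[where p = L and Q = R and c = L];
          use L(1) R R_add R_scale L_R scale in \<open>auto intro: less_imp_le\<close>)+
    with min[of N] have "L x \<le> L (x + y) - L y" by (auto simp: le_fun_def)
    then show "L x + L y \<le> L (x + y)" by simp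
  qed (rule sublinear_add[OF L(1)])
  have neg: "L (- x) = - L x" for x
    using add[of x "- x"] sublinear_zero[OF L(1)] by simp
  have "L (r *\<^sub>R x) = r * L x" for r x
    using sublinear_scaleR[OF L(1), of r x] sublinear_scaleR[OF L(1), of "- r" x] neg[of "r *\<^sub>R x"]
    by (cases "0 \<le> r") auto
  with add have "linear L" by (auto intro: linearI)
  moreover have "L x \<le> p x" for x
    using L(2) P(3)[of x] by (auto simp: le_fun_def intro: order_trans)
  moreover have "c g \<le> L g" if "g \<in> Q" for g
  proof -
    have "L (- g) \<le> p (- g + g) - c g"
      using L(2) P(2)[OF that, of "- g"] by (auto simp: le_fun_def intro: order_trans)
    then show ?thesis using sublinear_zero[OF p] neg by simp
  qed
  ultimately show thesis by (rule that)
qed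

section \<open>The weak* compact ball of a dual space\<close>

lemma bounded_clinear_apply: "bounded_clinear (cdual_apply g)"
  using cdual_apply[of g] by simp

lemma cdual_apply_add: "cdual_apply g (x + y) = cdual_apply g x + cdual_apply g y"
  and cdual_apply_scaleC: "cdual_apply g (c *\<^sub>C x) = c * cdual_apply g x"
  and cdual_apply_scaleR: "cdual_apply g (r *\<^sub>R x) = r * cdual_apply g x"
  using bounded_clinear_apply[of g]
  by (simp_all add: bounded_clinear_def bounded_linear.linear linear_add linear_cmul scaleC_complex_def
      scaleR_conv_of_real)

lemma norm_cdual_apply_le: "cmod (cdual_apply g x) \<le> norm g * norm x"
  unfolding norm_cdual.rep_eq
  by (rule onorm) (use bounded_clinear_apply[of g] in \<open>simp add: bounded_clinear_def\<close>)

lemma bounded_clinearI: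
  fixes h :: "'a::complex_normed_vector \<Rightarrow> complex"
  assumes "\<And>x y. h (x + y) = h x + h y" "\<And>c x. h (c *\<^sub>C x) = c * h x"
    and "\<And>x. cmod (h x) \<le> K * norm x"
  shows "bounded_clinear h"
  unfolding bounded_clinear_def scaleC_complex_def
proof (intro conjI bounded_linear_intro)
  show "h (r *\<^sub>R x) = r *\<^sub>R h x" for r x
    using assms(2)[of "complex_of_real r" x] by (simp add: scaleC_of_real scaleR_conv_of_real)
  show "cmod (h x) \<le> norm x * K" for x
    using assms(3)[of x] by (simp add: mult.commute)
qed (use assms in auto)

lemma cdual_in_cball_iff: "g \<in> cball 0 1 \<longleftrightarrow> (\<forall>x. cmod (cdual_apply g x) \<le> norm x)"
proof
  assume "g \<in> cball 0 1"
  then have "norm g * norm x \<le> norm x" for x by (simp add: mult_left_le_one_le)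
  then show "\<forall>x. cmod (cdual_apply g x) \<le> norm x" using norm_cdual_apply_le order_trans by blast
next
  assume "\<forall>x. cmod (cdual_apply g x) \<le> norm x"
  then have "norm g \<le> 1"
    unfolding norm_cdual.rep_eq by (intro onorm_bound) auto
  then show "g \<in> cball 0 1" by simp
qed

text \<open>
  A real-linear \<open>L \<le> norm\<close> with \<open>L v \<ge> norm v\<close> comes from the cone theorem applied to the ray
  through \<open>v\<close>, on which the norm is additive. The functional \<open>x \<mapsto> L x - \<i> L (\<i> x)\<close> is
  complex linear with real part \<open>L\<close>.
\<close>
theorem cdual_separates_points:
  fixes v :: "'a::complex_normed_vector"
  assumes "v \<noteq> 0"
  obtains g :: "'a cdual" where "cdual_apply g v \<noteq> 0"
proof -
  let ?Q = "{t *\<^sub>R v |t. 0 \<le> t}"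
  obtain L where L: "linear L" "\<And>x. L x \<le> norm x" "\<And>g. g \<in> ?Q \<Longrightarrow> norm g \<le> L g"
  proof (rule Mazur_Orlicz_cone[where p = norm and Q = ?Q and c = norm])
    show "sublinear (norm :: 'a \<Rightarrow> real)"
      by (rule sublinearI) (auto intro: norm_triangle_ineq)
    show "0 \<in> ?Q" by (auto intro: exI[of _ 0])
    show "g + h \<in> ?Q" if "g \<in> ?Q" "h \<in> ?Q" for g h
      using that by (auto simp flip: scaleR_add_left)
    show "r *\<^sub>R g \<in> ?Q" if "g \<in> ?Q" "0 < r" for g r
      using that by (force intro: mult_nonneg_nonneg)
    show "norm g + norm h \<le> norm (g + h)" if "g \<in> ?Q" "h \<in> ?Q" for g h
      using that by (auto simp: algebra_simps simp flip: scaleR_add_left)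
  qed auto
  interpret L: linear L by (rule L(1))
  have L_abs: "\<bar>L x\<bar> \<le> norm x" for x
    using L(2)[of x] L(2)[of "- x"] by (simp add: L.neg)
  define h where "h = (\<lambda>x. Complex (L x) (- L (\<i> *\<^sub>C x)))"
  have h_add: "h (x + y) = h x + h y" for x y
    by (simp add: h_def L.add scaleC_add_right complex_eq_iff)
  have h_scaleR: "h (r *\<^sub>R x) = r * h x" for r x
  proof -
    have "\<i> *\<^sub>C r *\<^sub>R x = r *\<^sub>R \<i> *\<^sub>C x"
      by (simp add: scaleC_scaleC mult.commute flip: scaleC_of_real)
    then show ?thesis by (simp add: h_def L.scale complex_eq_iff)
  qed
  have ii: "\<i> *\<^sub>C \<i> *\<^sub>C x = - x" for x :: 'a
    using scaleC_of_real[of "-1" x] by (simp add: scaleC_scaleC)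
  have h_i: "h (\<i> *\<^sub>C x) = \<i> * h x" for x
    by (simp add: h_def ii L.neg complex_eq_iff)
  have h_scaleC: "h (c *\<^sub>C x) = c * h x" for c x
  proof -
    have "c *\<^sub>C x = Re c *\<^sub>R x + Im c *\<^sub>R \<i> *\<^sub>C x"
      using complex_eq[of c]
      by (simp add: scaleC_scaleC mult.commute flip: scaleC_of_real scaleC_add_left)
    then have "h (c *\<^sub>C x) = (Re c + Im c * \<i>) * h x"
      by (simp add: h_add h_scaleR h_i algebra_simps)
    then show ?thesis using complex_eq[of c] by (simp add: mult.commute)
  qed
  have "cmod (h x) \<le> 2 * norm x" for x
    using L_abs[of x] L_abs[of "\<i> *\<^sub>C x"] cmod_le[of "h x"] by (simp add: h_def norm_scaleC)
  with h_add h_scaleC have "bounded_clinear h" by (rule bounded_clinearI)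
  then have "cdual_apply (Cdual h) = h" by (simp add: Cdual_inverse)
  moreover have "v \<in> ?Q" by (auto intro: exI[of _ 1])
  then have "h v \<noteq> 0"
    using L(3)[of v] assms by (auto simp: h_def complex_eq_iff)
  ultimately show thesis using that[of "Cdual h"] by simp
qed

lemma topspace_weak_star: "topspace weak_star = UNIV"
  unfolding weak_star_def topology_generated_by_topspace by auto

text \<open>
  Compactness and separation hold for the unit ball of every dual space; the case needed here is
  that of a bidual.
\<close>
definition dual_ball :: "'a::complex_normed_vector cdual topology"
  where "dual_ball = subtopology weak_star (cball 0 1)"

lemma topspace_dual_ball: "topspace dual_ball = cball 0 1"
  by (simp add: dual_ball_def topspace_weak_star)

lemma continuous_map_eval: "continuous_map weak_star euclidean (\<lambda>g. cdual_apply g x)"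
  unfolding continuous_map_alt
  unfolding topspace_weak_star
  by (auto simp: weak_star_def vimage_def intro!: topology_generated_by_Basis)

lemma continuous_map_eval_dual_ball: "continuous_map dual_ball euclidean (\<lambda>g. cdual_apply g x)"
  unfolding dual_ball_def by (intro continuous_map_from_subtopology continuous_map_eval)

lemma Hausdorff_dual_ball: "Hausdorff_space (dual_ball :: 'a::complex_normed_vector cdual topology)"
proof -
  have "Hausdorff_space (weak_star :: 'a cdual topology)"
    unfolding Hausdorff_space_def
  proof (intro allI impI)
    fix g h :: "'a cdual" assume "g \<in> topspace weak_star \<and> h \<in> topspace weak_star \<and> g \<noteq> h"
    then obtain x where "cdual_apply g x \<noteq> cdual_apply h x"
      using cdual_apply_inject by blast
    then obtain V W where VW: "open V" "open W" "cdual_apply g x \<in> V" "cdual_apply h x \<in> W" "V \<inter> W = {}"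
      using separation_t2 by metis
    let ?G = "\<lambda>V. {g \<in> topspace weak_star. cdual_apply g x \<in> V}"
    have "openin weak_star (?G V)" "openin weak_star (?G W)"
      using VW by (auto intro!: openin_continuous_map_preimage[OF continuous_map_eval])
    moreover have "g \<in> ?G V" "h \<in> ?G W" "disjnt (?G V) (?G W)"
      using VW by (auto simp: topspace_weak_star disjnt_def)
    ultimately show "\<exists>U V. openin weak_star U \<and> openin weak_star V \<and> g \<in> U \<and> h \<in> V \<and> disjnt U V"
      by blast
  qed
  then show ?thesis unfolding dual_ball_def by (rule Hausdorff_space_subtopology)
qed

text \<open>
  The functionals of norm at most one are exactly the additive and homogeneous points of the product
  of the discs of radius \<open>norm x\<close>. That product is compact by Tychonoff's theorem, the algebraic
  conditions are closed in it, and the weak* topology is the one inherited from the product.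
\<close>
theorem Banach_Alaoglu: "compact_space (dual_ball :: 'a::complex_normed_vector cdual topology)"
proof -
  let ?P = "\<Pi>\<^sub>E x\<in>(UNIV :: 'a set). cball (0 :: complex) (norm x)"
  let ?S = "?P \<inter> (\<Inter>x y. {h. h (x + y) = h x + h y}) \<inter> (\<Inter>c x. {h. h (c *\<^sub>C x) = c * h x})"
  have "compact ?P"
    unfolding compactin_euclidean_iff[symmetric] euclidean_product_topology[symmetric]
      compactin_PiE by (simp add: compactin_euclidean_iff)
  moreover have "closed (\<Inter>x y. {h :: 'a \<Rightarrow> complex. h (x + y) = h x + h y})"
      "closed (\<Inter>c x. {h :: 'a \<Rightarrow> complex. h (c *\<^sub>C x) = c * h x})"
    by (intro closed_INT ballI closed_Collect_eq continuous_intros continuous_on_product_coordinates)+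
  ultimately have S: "compact ?S" by (intro compact_Int_closed)
  have S_bound: "cmod (h x) \<le> norm x" if "h \<in> ?S" for h x
    using that by auto
  then have S_clin: "bounded_clinear h" if "h \<in> ?S" for h
    using that by (intro bounded_clinearI[where K = 1]) auto
  then have app: "cdual_apply (Cdual h) = h" if "h \<in> ?S" for h
    using that by (simp add: Cdual_inverse)
  have "continuous_map (top_of_set ?S) weak_star Cdual"
    unfolding weak_star_def
  proof (rule continuous_on_generated_topo)
    fix U assume "U \<in> {{g :: 'a cdual. cdual_apply g x \<in> V} |x V. open V}"
    then obtain x V where U: "U = {g. cdual_apply g x \<in> V}" and V: "open V" by blast
    have "Cdual -` U \<inter> ?S = ?S \<inter> (\<lambda>h. h x) -` V" using app by (auto simp: U)
    moreover have "openin (top_of_set ?S) (?S \<inter> (\<lambda>h. h x) -` V)"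
      using V by (intro continuous_openin_preimage_gen
          continuous_on_subset[OF continuous_on_product_coordinates]) auto
    ultimately show "openin (top_of_set ?S) (Cdual -` U \<inter> topspace (top_of_set ?S))" by simp
  next
    show "Cdual ` topspace (top_of_set ?S) \<subseteq> \<Union> {{g :: 'a cdual. cdual_apply g x \<in> V} |x V. open V}"
      using topspace_weak_star[where 'a = 'a]
      unfolding weak_star_def topology_generated_by_topspace by (metis subset_UNIV)
  qed
  moreover have "compactin (top_of_set ?S) ?S" using S by (simp add: compactin_subtopology)
  ultimately have "compactin weak_star (Cdual ` ?S)" by (rule image_compactin[rotated])
  moreover have "Cdual ` ?S = cball 0 1"
  proof (intro equalityI subsetI)
    fix g :: "'a cdual" assume "g \<in> Cdual ` ?S"
    then obtain h where h: "h \<in> ?S" "g = Cdual h" by (rule imageE)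
    show "g \<in> cball 0 1"
      unfolding cdual_in_cball_iff h(2) app[OF h(1)] using S_bound[OF h(1)] by (rule allI)
  next
    fix g :: "'a cdual" assume "g \<in> cball 0 1"
    then have "cdual_apply g \<in> ?S"
      unfolding cdual_in_cball_iff by (auto simp: cdual_apply_add cdual_apply_scaleC)
    then have "Cdual (cdual_apply g) \<in> Cdual ` ?S" by (rule imageI)
    then show "g \<in> Cdual ` ?S" unfolding cdual_apply_inverse .
  qed
  ultimately show ?thesis
    by (simp add: dual_ball_def compactin_subtopology compact_space_subtopology)
qed

lemma bidual_ball_eq: "bidual_ball = dual_ball"
  by (simp add: bidual_ball_def dual_ball_def)

section \<open>Regular measures from finitely additive ones\<close>

text \<open>
  The set function \<open>m\<close> models a finitely additive probability known only on closed sets. It need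
  not be regular, so the regular measure built from it dominates it on closed sets but may
  exceed it there.
\<close>
locale closed_content =
  fixes X :: "'a topology" and m :: "'a set \<Rightarrow> ennreal"
  assumes compact: "compact_space X" and normal: "normal_space X"
    and m_mono: "closedin X C \<Longrightarrow> closedin X D \<Longrightarrow> C \<subseteq> D \<Longrightarrow> m C \<le> m D"
    and m_Un: "closedin X C \<Longrightarrow> closedin X D \<Longrightarrow> m (C \<union> D) \<le> m C + m D"
    and m_disjoint: "closedin X C \<Longrightarrow> closedin X D \<Longrightarrow> C \<inter> D = {} \<Longrightarrow> m C + m D \<le> m (C \<union> D)"
    and m_empty: "m {} = 0" and m_space: "m (topspace X) = 1"
begin

definition inner_content :: "'a set \<Rightarrow> ennreal"
  where "inner_content V = (SUP D\<in>{D. closedin X D \<and> D \<subseteq> V}. m D)"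

definition outer_content :: "'a set \<Rightarrow> ennreal"
  where "outer_content A = (INF V\<in>{V. openin X V \<and> A \<subseteq> V}. inner_content V)"

lemma inner_content_upper: "closedin X D \<Longrightarrow> D \<subseteq> V \<Longrightarrow> m D \<le> inner_content V"
  unfolding inner_content_def by (rule SUP_upper) simp

lemma inner_content_least: "(\<And>D. closedin X D \<Longrightarrow> D \<subseteq> V \<Longrightarrow> m D \<le> b) \<Longrightarrow> inner_content V \<le> b"
  unfolding inner_content_def by (rule SUP_least) simp

lemma outer_content_lower: "openin X V \<Longrightarrow> A \<subseteq> V \<Longrightarrow> outer_content A \<le> inner_content V"
  unfolding outer_content_def by (rule INF_lower) simp

lemma outer_content_greatest: "(\<And>V. openin X V \<Longrightarrow> A \<subseteq> V \<Longrightarrow> b \<le> inner_content V) \<Longrightarrow> b \<le> outer_content A"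
  unfolding outer_content_def by (rule INF_greatest) simp

lemma inner_content_mono: "V \<subseteq> W \<Longrightarrow> inner_content V \<le> inner_content W"
  by (rule inner_content_least, rule inner_content_upper) auto

lemma outer_content_mono: "A \<subseteq> B \<Longrightarrow> outer_content A \<le> outer_content B"
  by (rule outer_content_greatest, rule outer_content_lower) auto

lemma outer_content_open: "openin X V \<Longrightarrow> outer_content V = inner_content V"
  by (intro antisym outer_content_lower outer_content_greatest inner_content_mono) auto

lemma content_le_outer: "closedin X D \<Longrightarrow> m D \<le> outer_content D"
  by (intro outer_content_greatest inner_content_upper)

lemma outer_content_space: "outer_content (topspace X) = 1"
  unfolding outer_content_open[OF openin_topspace]
  by (metis antisym closedin_subset closedin_topspace inner_content_least inner_content_upper m_mono m_space order_refl)

lemma outer_content_empty: "outer_content {} = 0"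
  unfolding outer_content_open[OF openin_empty]
  by (metis antisym inner_content_least m_empty order_refl subset_empty zero_le)

text \<open>
  Normality lets a closed subset of \<open>V \<union> W\<close> be cut into a closed part inside \<open>V\<close> and a closed
  part inside \<open>W\<close>.
\<close>
lemma inner_content_Un:
  assumes V: "openin X V" and W: "openin X W"
  shows "inner_content (V \<union> W) \<le> inner_content V + inner_content W"
proof (rule inner_content_least)
  fix D assume D: "closedin X D" "D \<subseteq> V \<union> W"
  then have "closedin X (D - V)" "D - V \<subseteq> W" using V by auto
  with W obtain G where G: "openin X G" "D - V \<subseteq> G" "X closure_of G \<subseteq> W"
    using normal unfolding normal_space_alt by meson
  have "G \<subseteq> X closure_of G"
    using G(1) by (simp add: closure_of_subset openin_subset)
  then have "D = (D - G) \<union> (D \<inter> X closure_of G)" by auto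
  then have "m D \<le> m (D - G) + m (D \<inter> X closure_of G)"
    using D(1) G(1) m_Un[of "D - G" "D \<inter> X closure_of G"] by (metis closedin_Int closedin_closure_of closedin_diff)
  also have "\<dots> \<le> inner_content V + inner_content W"
    using D G by (intro add_mono inner_content_upper closedin_diff closedin_Int closedin_closure_of) auto
  finally show "m D \<le> inner_content V + inner_content W" .
qed

lemma inner_content_UN_finite:
  fixes n :: nat
  assumes "\<And>i. openin X (V i)"
  shows "inner_content (\<Union>i<n. V i) \<le> (\<Sum>i<n. inner_content (V i))"
proof (induction n)
  case 0
  show ?case using outer_content_empty outer_content_open[OF openin_empty] by simp
next
  case (Suc n)
  have "inner_content (\<Union>i<Suc n. V i) \<le> inner_content (\<Union>i<n. V i) + inner_content (V n)"
    using inner_content_Un[of "\<Union>i<n. V i" "V n"] assms by (auto simp: lessThan_Suc Un_commute)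
  also have "\<dots> \<le> (\<Sum>i<Suc n. inner_content (V i))" using Suc by (simp add: add_mono)
  finally show ?case .
qed

text \<open>
  This is where countable additivity enters: a closed set inside a countable union of open sets is
  compact, hence lies inside a finite subunion.
\<close>
lemma inner_content_UN:
  fixes V :: "nat \<Rightarrow> 'a set"
  assumes V: "\<And>i. openin X (V i)"
  shows "inner_content (\<Union>i. V i) \<le> (\<Sum>i. inner_content (V i))"
proof (rule inner_content_least)
  fix D assume D: "closedin X D" "D \<subseteq> (\<Union>i. V i)"
  then have "compactin X D" using closedin_compact_space[OF compact] by blast
  then obtain \<F> where \<F>: "finite \<F>" "\<F> \<subseteq> range V" "D \<subseteq> \<Union>\<F>"
    using D(2) V unfolding compactin_def by (metis (no_types, lifting) imageE)
  then obtain I where I: "finite I" "\<F> = V ` I" by (meson finite_subset_image)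
  then obtain n where "I \<subseteq> {..<n}" using finite_nat_bounded by blast
  with \<F>(3) I(2) have "D \<subseteq> (\<Union>i<n. V i)" by auto
  then have "m D \<le> inner_content (\<Union>i<n. V i)" using D(1) by (rule inner_content_upper[rotated])
  also have "\<dots> \<le> (\<Sum>i<n. inner_content (V i))" using V by (rule inner_content_UN_finite)
  also have "\<dots> \<le> (\<Sum>i. inner_content (V i))" by (rule sum_le_suminf) auto
  finally show "m D \<le> (\<Sum>i. inner_content (V i))" .
qed

lemma outer_content_UN:
  fixes A :: "nat \<Rightarrow> 'a set"
  shows "outer_content (\<Union>i. A i) \<le> (\<Sum>i. outer_content (A i))"
proof (rule ennreal_le_epsilon)
  fix e :: real assume e: "0 < e" and fin: "(\<Sum>i. outer_content (A i)) < top"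
  have "\<exists>V. openin X V \<and> A i \<subseteq> V \<and> inner_content V < outer_content (A i) + e * (1/2) ^ Suc i" for i
    using INF_approx_ennreal[of "e * (1/2) ^ Suc i" "outer_content (A i)", OF _ outer_content_def] e fin
    by (auto dest!: ennreal_suminf_lessD simp: less_top)
  then obtain V where V: "\<And>i. openin X (V i)" "\<And>i. A i \<subseteq> V i"
      "\<And>i. inner_content (V i) < outer_content (A i) + e * (1/2) ^ Suc i"
    by metis
  have "outer_content (\<Union>i. A i) \<le> inner_content (\<Union>i. V i)"
    using V(1,2) by (intro outer_content_lower) auto
  also have "\<dots> \<le> (\<Sum>i. inner_content (V i))" using V(1) by (rule inner_content_UN)
  also have "\<dots> \<le> (\<Sum>i. outer_content (A i) + e * (1/2) ^ Suc i)"
    using V(3) by (intro suminf_le) (auto intro: less_imp_le)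
  also have "\<dots> = (\<Sum>i. outer_content (A i)) + (\<Sum>i. ennreal e * ennreal ((1/2) ^ Suc i))"
    using e by (subst suminf_add[symmetric])
      (auto simp del: ennreal_suminf_cmult simp add: ennreal_mult[symmetric])
  also have "\<dots> = (\<Sum>i. outer_content (A i)) + e"
    unfolding ennreal_suminf_cmult
    by (subst suminf_ennreal_eq[OF zero_le_power power_half_series]) auto
  finally show "outer_content (\<Union>i. A i) \<le> (\<Sum>i. outer_content (A i)) + e" .
qed

lemma outer_content_Un: "outer_content (A \<union> B) \<le> outer_content A + outer_content B"
proof -
  have "outer_content (\<Union>i. if i = 0 then A else if i = Suc 0 then B else {})
      \<le> (\<Sum>i. outer_content (if i = 0 then A else if i = Suc 0 then B else {}))"
    by (rule outer_content_UN)
  also have "\<dots> = (\<Sum>i\<in>{0, Suc 0}. outer_content (if i = 0 then A else if i = Suc 0 then B else {}))"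
    by (rule suminf_finite) (auto simp: outer_content_empty)
  also have "(\<Union>i. if i = 0 then A else if i = Suc 0 then B else {}) = A \<union> B"
    by (auto split: if_splits)
  finally show ?thesis by simp
qed

text \<open>
  Open sets satisfy Caratheodory's criterion. For \<open>A\<close> inside an open \<open>W\<close>, a closed \<open>D\<close> that
  nearly exhausts \<open>W \<inter> V\<close> leaves the open set \<open>W - D\<close>, which covers \<open>W - V\<close>; a closed subset of
  \<open>W - D\<close> is disjoint from \<open>D\<close>, so both together fit into \<open>W\<close>.
\<close>
lemma open_splits_outer:
  assumes V: "openin X V"
  shows "outer_content (A \<inter> V) + outer_content (A - V) \<le> outer_content A"
proof (rule outer_content_greatest)
  fix W assume W: "openin X W" "A \<subseteq> W"
  have "m D + outer_content (W - V) \<le> inner_content W" if D: "closedin X D" "D \<subseteq> W \<inter> V" for D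
  proof -
    have "m D + outer_content (W - V) \<le> m D + inner_content (W - D)"
      using D W V by (intro add_mono outer_content_lower) auto
    also have "\<dots> = (SUP D'\<in>{D'. closedin X D' \<and> D' \<subseteq> W - D}. m D + m D')"
      unfolding inner_content_def add.commute[of "m D"] by (rule ennreal_SUP_add_left[symmetric]) auto
    also have "\<dots> \<le> inner_content W"
    proof (rule SUP_least)
      fix D' assume "D' \<in> {D'. closedin X D' \<and> D' \<subseteq> W - D}"
      then have "m D + m D' \<le> m (D \<union> D')" "m (D \<union> D') \<le> inner_content W"
        using D by (auto intro!: m_disjoint inner_content_upper)
      then show "m D + m D' \<le> inner_content W" by (rule order_trans)
    qed
    finally show ?thesis .
  qed
  then have "(SUP D\<in>{D. closedin X D \<and> D \<subseteq> W \<inter> V}. m D + outer_content (W - V)) \<le> inner_content W"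
    by (intro SUP_least) auto
  moreover have "(SUP D\<in>{D. closedin X D \<and> D \<subseteq> W \<inter> V}. m D + outer_content (W - V))
      = inner_content (W \<inter> V) + outer_content (W - V)"
    unfolding inner_content_def by (rule ennreal_SUP_add_left) auto
  moreover have "outer_content (A \<inter> V) \<le> inner_content (W \<inter> V)" "outer_content (A - V) \<le> outer_content (W - V)"
    using W V by (auto intro!: outer_content_lower outer_content_mono)
  ultimately show "outer_content (A \<inter> V) + outer_content (A - V) \<le> inner_content W"
    by (metis add_mono order_trans)
qed

definition borel_sets :: "'a set set"
  where "borel_sets = sigma_sets (topspace X) {V. openin X V}"

lemma measure_space_outer: "measure_space (topspace X) borel_sets outer_content"
proof -
  interpret Pow: sigma_algebra "topspace X" "Pow (topspace X)" by (rule sigma_algebra_Pow)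
  let ?L = "lambda_system (topspace X) (Pow (topspace X)) outer_content"
  have "outer_measure_space (Pow (topspace X)) outer_content"
    by (auto simp: outer_measure_space_def positive_def increasing_def countably_subadditive_def
        outer_content_empty outer_content_mono outer_content_UN)
  then have L: "measure_space (topspace X) ?L outer_content" by (rule Pow.caratheodory_lemma)
  have "outer_content (A \<inter> V) + outer_content (A - V) = outer_content A" if "openin X V" for V A
    using open_splits_outer[OF that] outer_content_Un[of "A \<inter> V" "A - V"]
    by (intro antisym) (auto simp: Int_Diff_Un)
  then have "{V. openin X V} \<subseteq> ?L"
    by (auto simp: Pow.lambda_system_eq dest: openin_subset)
  then have "borel_sets \<subseteq> ?L"
    using L unfolding borel_sets_def measure_space_def by (intro sigma_algebra.sigma_sets_subset) auto
  then show ?thesis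
    unfolding borel_sets_def using L
    by (intro measure_down[OF L] sigma_algebra_sigma_sets) (auto dest: openin_subset)
qed

definition reg_measure :: "'a measure"
  where "reg_measure = measure_of (topspace X) borel_sets outer_content"

lemma space_reg_measure: "space reg_measure = topspace X"
  and sets_reg_measure: "sets reg_measure = borel_sets"
  and emeasure_reg_measure: "A \<in> borel_sets \<Longrightarrow> emeasure reg_measure A = outer_content A"
proof -
  note meas = measure_space_outer
  have Pow: "borel_sets \<subseteq> Pow (topspace X)"
    unfolding borel_sets_def using openin_subset[of X]
    by (auto dest: sigma_sets_into_sp[rotated])
  show "space reg_measure = topspace X" unfolding reg_measure_def by (rule space_measure_of[OF Pow])
  show sets: "sets reg_measure = borel_sets"
    unfolding reg_measure_def using meas by (simp add: sigma_algebra.sets_measure_of_eq measure_space_def)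
  show "emeasure reg_measure A = outer_content A" if "A \<in> borel_sets"
    using meas that sets by (intro emeasure_measure_of[OF reg_measure_def Pow]) (auto simp: measure_space_def)
qed

lemma open_borel: "openin X V \<Longrightarrow> V \<in> borel_sets"
  unfolding borel_sets_def by auto

lemma closed_borel: "closedin X D \<Longrightarrow> D \<in> borel_sets"
  unfolding borel_sets_def closedin_def
  by (metis (no_types, lifting) Diff_Diff_Int inf.absorb2 mem_Collect_eq sigma_sets.Basic sigma_sets.Compl)

lemma content_le_reg_measure: "closedin X D \<Longrightarrow> m D \<le> emeasure reg_measure D"
  by (simp add: emeasure_reg_measure closed_borel content_le_outer)

lemma prob_space_reg_measure: "prob_space reg_measure"
  by (rule prob_spaceI) (simp add: space_reg_measure emeasure_reg_measure open_borel outer_content_space)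

lemma reg_measure_outer_regular:
  assumes "A \<in> borel_sets"
  shows "emeasure reg_measure A = (INF V\<in>{V. openin X V \<and> A \<subseteq> V}. emeasure reg_measure V)"
  unfolding emeasure_reg_measure[OF assms] outer_content_def
  by (intro INF_cong) (auto simp: emeasure_reg_measure open_borel outer_content_open)

text \<open>
  Outer regularity is built into the definition. Inner regularity follows by complementation,
  because complements of open sets are compact.
\<close>
theorem borel_regular_prob_reg_measure: "borel_regular_prob X reg_measure"
proof -
  interpret prob_space reg_measure by (rule prob_space_reg_measure)
  have "emeasure reg_measure A = (SUP K\<in>{K. compactin X K \<and> K \<subseteq> A}. emeasure reg_measure K)"
    if A: "A \<in> borel_sets" for A
  proof (rule antisym)
    let ?S = "SUP K\<in>{K. compactin X K \<and> K \<subseteq> A}. emeasure reg_measure K"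
    have cA: "topspace X - A \<in> borel_sets"
      using A unfolding borel_sets_def by (rule sigma_sets.Compl)
    have "1 - ?S \<le> outer_content (topspace X - A)"
    proof (rule outer_content_greatest)
      fix V assume V: "openin X V" "topspace X - A \<subseteq> V"
      then have "compactin X (topspace X - V)" "topspace X - V \<subseteq> A"
        using closedin_compact_space[OF compact] closedin_diff[OF closedin_topspace] by blast+
      then have "emeasure reg_measure (topspace X - V) \<le> ?S" by (intro SUP_upper) simp
      moreover have "emeasure reg_measure V + emeasure reg_measure (topspace X - V) = 1"
        using V plus_emeasure[of V reg_measure "topspace X - V"] emeasure_space_1 openin_subset[OF V(1)]
        by (simp add: space_reg_measure sets_reg_measure open_borel closed_borel closedin_diff Un_absorb1)
      ultimately have "1 \<le> inner_content V + ?S"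
        using V(1) by (metis add_left_mono emeasure_reg_measure open_borel outer_content_open)
      then show "1 - ?S \<le> inner_content V" by (simp add: ennreal_minus_le_iff add.commute)
    qed
    then have "1 \<le> outer_content (topspace X - A) + ?S"
      by (simp add: ennreal_minus_le_iff add.commute)
    moreover have "emeasure reg_measure (topspace X - A) + emeasure reg_measure A = 1"
      using plus_emeasure[of "topspace X - A" reg_measure A] emeasure_space_1 A cA sets.sets_into_space[of A reg_measure]
      by (simp add: space_reg_measure sets_reg_measure Un_absorb2 Diff_Int_distrib2)
    ultimately have "emeasure reg_measure (topspace X - A) + emeasure reg_measure A \<le> emeasure reg_measure (topspace X - A) + ?S"
      using cA by (simp add: emeasure_reg_measure)
    then show "emeasure reg_measure A \<le> ?S"
      unfolding ennreal_add_left_cancel_le by simp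
  next
    show "(SUP K\<in>{K. compactin X K \<and> K \<subseteq> A}. emeasure reg_measure K) \<le> emeasure reg_measure A"
      using A by (intro SUP_least emeasure_mono) (auto simp: sets_reg_measure)
  qed
  moreover have "borel_sets = sets (sigma (topspace X) {V. openin X V})"
    unfolding borel_sets_def using openin_subset[of X] by (subst sets_measure_of) auto
  ultimately show ?thesis
    unfolding borel_regular_prob_def
    using prob_space_reg_measure reg_measure_outer_regular sets_reg_measure by blast
qed

end

section \<open>A regular measure nonnegative on a cone of continuous functions\<close>

text \<open>
  A mean is a finitely additive probability on all subsets of \<open>K\<close>, presented through its integral
  of bounded functions.
\<close>
locale mean_on =
  fixes K :: "'a set" and \<Lambda> :: "('a \<Rightarrow> real) \<Rightarrow> real"
  assumes add: "bounded (h ` K) \<Longrightarrow> bounded (k ` K) \<Longrightarrow> \<Lambda> (\<lambda>z. h z + k z) = \<Lambda> h + \<Lambda> k"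
    and scale: "bounded (h ` K) \<Longrightarrow> \<Lambda> (\<lambda>z. c * h z) = c * \<Lambda> h"
    and mono: "bounded (h ` K) \<Longrightarrow> bounded (k ` K) \<Longrightarrow> (\<And>z. z \<in> K \<Longrightarrow> h z \<le> k z) \<Longrightarrow> \<Lambda> h \<le> \<Lambda> k"
    and one: "\<Lambda> (\<lambda>_. 1) = 1"

text \<open>
  The cone theorem for the sublinear functional \<open>sup\<close> on the bounded functions, with \<open>c = 0\<close>.
  A linear functional below \<open>sup\<close> is monotone and takes the value 1 at the constant 1. The
  bounded functions are realised as the bounded continuous functions on a discrete space; the
  functional ignores the values outside \<open>K\<close>, so every function bounded on \<open>K\<close> can be cut off to
  zero there.
\<close>
lemma mean_nonneg_on_cone:
  fixes K :: "'a set" and G :: "('a \<Rightarrow> real) set"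
  assumes K: "K \<noteq> {}"
    and G_bdd: "\<And>g. g \<in> G \<Longrightarrow> bounded (g ` K)"
    and G0: "(\<lambda>_. 0) \<in> G"
    and G_add: "\<And>g h. g \<in> G \<Longrightarrow> h \<in> G \<Longrightarrow> (\<lambda>z. g z + h z) \<in> G"
    and G_scale: "\<And>g r. g \<in> G \<Longrightarrow> 0 < r \<Longrightarrow> (\<lambda>z. r * g z) \<in> G"
    and G_Sup: "\<And>g. g \<in> G \<Longrightarrow> 0 \<le> (SUP z\<in>K. g z)"
  obtains \<Lambda> where "mean_on K \<Lambda>" "\<And>g. g \<in> G \<Longrightarrow> 0 \<le> \<Lambda> g"
proof -
  define p :: "('a discrete \<Rightarrow>\<^sub>C real) \<Rightarrow> real" where "p = (\<lambda>\<phi>. SUP z\<in>K. \<phi> (discrete z))"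
  define Q :: "('a discrete \<Rightarrow>\<^sub>C real) set" where "Q = {\<phi>. \<exists>g\<in>G. \<forall>z\<in>K. apply_bcontfun \<phi> (discrete z) = g z}"
  have bdd: "bdd_above ((\<lambda>z. apply_bcontfun \<phi> (discrete z)) ` K)" for \<phi> :: "'a discrete \<Rightarrow>\<^sub>C real"
    by (rule bounded_imp_bdd_above, rule bounded_subset[OF bounded_apply_bcontfun[of \<phi>]]) auto
  have p_upper: "apply_bcontfun \<phi> (discrete z) \<le> p \<phi>" if "z \<in> K" for \<phi> z
    unfolding p_def using that bdd by (intro cSUP_upper)
  have p_least: "p \<phi> \<le> b" if "\<And>z. z \<in> K \<Longrightarrow> apply_bcontfun \<phi> (discrete z) \<le> b" for \<phi> b
    unfolding p_def using K that by (intro cSUP_least)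
  have p_zero: "p 0 = 0" using K by (simp add: p_def)
  obtain L where L: "linear L" "\<And>\<phi>. L \<phi> \<le> p \<phi>" "\<And>\<phi>. \<phi> \<in> Q \<Longrightarrow> 0 \<le> L \<phi>"
  proof (rule Mazur_Orlicz_cone[where p = p and Q = Q and c = "\<lambda>_. 0"])
    show "sublinear p"
    proof (rule sublinearI)
      show "p (\<phi> + \<psi>) \<le> p \<phi> + p \<psi>" for \<phi> \<psi>
        by (rule p_least) (simp add: add_mono p_upper)
      show "p (r *\<^sub>R \<phi>) \<le> r * p \<phi>" if "0 < r" for r \<phi>
        using that by (intro p_least) (simp add: p_upper)
    qed (rule p_zero)
    show "0 \<in> Q" unfolding Q_def using G0 by force
    show "\<phi> + \<psi> \<in> Q" if \<phi>: "\<phi> \<in> Q" and \<psi>: "\<psi> \<in> Q" for \<phi> \<psi>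
    proof -
      from \<phi> \<psi> obtain g h where "g \<in> G" "h \<in> G"
          "\<forall>z\<in>K. apply_bcontfun \<phi> (discrete z) = g z" "\<forall>z\<in>K. apply_bcontfun \<psi> (discrete z) = h z"
        unfolding Q_def by blast
      then show ?thesis
        unfolding Q_def using G_add[of g h] by (auto intro!: bexI[of _ "\<lambda>z. g z + h z"])
    qed
    show "r *\<^sub>R \<phi> \<in> Q" if \<phi>: "\<phi> \<in> Q" and r: "0 < r" for \<phi> r
    proof -
      from \<phi> obtain g where "g \<in> G" "\<forall>z\<in>K. apply_bcontfun \<phi> (discrete z) = g z"
        unfolding Q_def by blast
      then show ?thesis
        unfolding Q_def using G_scale[of g r] r by (auto intro!: bexI[of _ "\<lambda>z. r * g z"])
    qed
    show "0 \<le> p \<phi>" if \<phi>: "\<phi> \<in> Q" for \<phi>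
    proof -
      from \<phi> obtain g where "g \<in> G" "\<forall>z\<in>K. apply_bcontfun \<phi> (discrete z) = g z"
        unfolding Q_def by blast
      then show ?thesis using G_Sup[of g] by (simp add: p_def)
    qed
  qed auto
  interpret L: linear L by (rule L(1))
  have L_mono: "L \<phi> \<le> L \<psi>"
    if "\<And>z. z \<in> K \<Longrightarrow> apply_bcontfun \<phi> (discrete z) \<le> apply_bcontfun \<psi> (discrete z)" for \<phi> \<psi>
  proof -
    have "L (\<phi> - \<psi>) \<le> 0"
      using that by (intro order_trans[OF L(2)] p_least) simp
    then show ?thesis by (simp add: L.diff)
  qed
  define ext :: "('a \<Rightarrow> real) \<Rightarrow> 'a discrete \<Rightarrow>\<^sub>C real"
    where "ext = (\<lambda>h. Bcontfun (\<lambda>d. if of_discrete d \<in> K then h (of_discrete d) else 0))"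
  have ext: "apply_bcontfun (ext h) d = (if of_discrete d \<in> K then h (of_discrete d) else 0)"
    if "bounded (h ` K)" for h d
  proof -
    have "range (\<lambda>d. if of_discrete d \<in> K then h (of_discrete d) else 0) \<subseteq> insert 0 (h ` K)"
      by auto
    moreover have "bounded (insert 0 (h ` K))" using that by simp
    ultimately have "bounded (range (\<lambda>d. if of_discrete d \<in> K then h (of_discrete d) else 0))"
      by (rule bounded_subset[rotated])
    then have "(\<lambda>d. if of_discrete d \<in> K then h (of_discrete d) else 0) \<in> bcontfun"
      unfolding bcontfun_def by (simp add: continuous_on_open_vimage open_discrete)
    then show ?thesis unfolding ext_def by (simp add: Bcontfun_inverse)
  qed
  have disc: "of_discrete (discrete z) = z" for z :: 'a by (simp add: discrete_inverse)
  have add_bdd: "bounded ((\<lambda>z. h z + k z) ` K)" if "bounded (h ` K)" "bounded (k ` K)" for h k :: "'a \<Rightarrow> real"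
    using bounded_plus_comp[OF that] .
  have scale_bdd: "bounded ((\<lambda>z. c * h z) ` K)" if "bounded (h ` K)" for c and h :: "'a \<Rightarrow> real"
    using bounded_scaling[OF that, of c] by (simp add: image_image)
  show thesis
  proof (rule that)
    show "mean_on K (\<lambda>h. L (ext h))"
    proof
      fix h k :: "'a \<Rightarrow> real" and c :: real
      assume h: "bounded (h ` K)"
      have "ext (\<lambda>z. c * h z) = c *\<^sub>R ext h"
        by (rule bcontfun_eqI) (simp add: ext h scale_bdd)
      then show "L (ext (\<lambda>z. c * h z)) = c * L (ext h)" by (simp add: L.scale)
      assume k: "bounded (k ` K)"
      have "ext (\<lambda>z. h z + k z) = ext h + ext k"
        by (rule bcontfun_eqI) (simp add: ext h k add_bdd)
      then show "L (ext (\<lambda>z. h z + k z)) = L (ext h) + L (ext k)" by (simp add: L.add)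
      show "L (ext h) \<le> L (ext k)" if "\<And>z. z \<in> K \<Longrightarrow> h z \<le> k z"
        using that by (intro L_mono) (simp add: ext h k disc)
    next
      have one: "bounded ((\<lambda>_. 1 :: real) ` K)" by (simp add: image_constant_conv)
      have "L (ext (\<lambda>_. 1)) \<le> 1"
        by (rule order_trans[OF L(2)], rule p_least) (simp add: ext one disc)
      moreover have "L (- ext (\<lambda>_. 1)) \<le> -1"
        by (rule order_trans[OF L(2)], rule p_least) (simp add: ext one disc)
      ultimately show "L (ext (\<lambda>_. 1)) = 1" by (simp add: L.neg)
    qed
    show "0 \<le> L (ext g)" if "g \<in> G" for g
      using that G_bdd[OF that] by (intro L(3)) (auto simp: Q_def ext disc)
  qed
qed

lemma space_borel_regular_prob: "borel_regular_prob X M \<Longrightarrow> space M = topspace X"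
  using sets_eq_imp_space_eq[of M "sigma (topspace X) {V. openin X V}"] openin_subset[of X]
  by (auto simp: borel_regular_prob_def space_measure_of_conv)

lemma borel_regular_prob_measurable:
  fixes f :: "'a \<Rightarrow> 'b::topological_space"
  assumes M: "borel_regular_prob X M" and f: "continuous_map X euclidean f"
  shows "f \<in> borel_measurable M"
proof (rule borel_measurableI)
  fix S :: "'b set" assume "open S"
  then have "openin X (f -` S \<inter> space M)"
    using f by (simp add: continuous_map_alt space_borel_regular_prob[OF M])
  moreover have "sets M = sigma_sets (topspace X) {V. openin X V}"
    using M openin_subset[of X] unfolding borel_regular_prob_def
    by (metis (no_types, lifting) PowI mem_Collect_eq sets_measure_of subsetI)
  ultimately show "f -` S \<inter> space M \<in> sets M" by auto
qed

lemma borel_regular_prob_integrable: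
  fixes f :: "'a \<Rightarrow> real"
  assumes "borel_regular_prob X M" "continuous_map X euclidean f" "bounded (f ` topspace X)"
  shows "integrable M f"
proof -
  interpret prob_space M using assms(1) by (simp add: borel_regular_prob_def)
  obtain B where "\<And>z. z \<in> topspace X \<Longrightarrow> norm (f z) \<le> B"
    using assms(3) by (auto simp: bounded_iff)
  then show ?thesis
    using assms(1,2) by (intro integrable_const_bound[of _ B])
      (auto simp: space_borel_regular_prob borel_regular_prob_measurable)
qed

text \<open>
  Both bounds express that the number of \<open>k\<close> in \<open>{1..n}\<close> with \<open>k \<le> n t\<close> is the integer part
  of \<open>n t\<close>. They compare a function with values in the unit interval to the average of the
  indicators of its superlevel sets.
\<close>
lemma layer_sum:
  fixes t :: real
  assumes "0 \<le> t" "t \<le> 1"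
  shows "(\<Sum>k=1..n. if real k \<le> n * t then 1 else 0 :: real) \<le> n * t"
    and "n * t \<le> 1 + (\<Sum>k=1..n. if real k \<le> n * t then 1 else 0)"
proof -
  have "k \<le> n" if "real k \<le> n * t" for k
    using that mult_left_le[OF assms(2), of "real n"] by simp
  moreover have "k \<le> nat \<lfloor>n * t\<rfloor> \<longleftrightarrow> real k \<le> n * t" for k
    using assms(1) by (simp add: le_nat_iff le_floor_iff)
  ultimately have "{k \<in> {1..n}. real k \<le> n * t} = {1..nat \<lfloor>n * t\<rfloor>}" by auto
  then have "(\<Sum>k=1..n. if real k \<le> n * t then 1 else 0 :: real) = real (nat \<lfloor>n * t\<rfloor>)"
    by (simp flip: sum.inter_filter)
  moreover have "0 \<le> \<lfloor>n * t\<rfloor>" using assms(1) by simp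
  ultimately show "(\<Sum>k=1..n. if real k \<le> n * t then 1 else 0 :: real) \<le> n * t"
    and "n * t \<le> 1 + (\<Sum>k=1..n. if real k \<le> n * t then 1 else 0)"
    by linarith+
qed

text \<open>
  The cone lemma gives a mean \<open>\<Lambda>\<close> that is nonnegative on \<open>G\<close>, and its values on closed sets give
  a regular measure \<open>M\<close>. It is enough that \<open>\<Lambda> g \<le> \<integral> g dM\<close> for continuous \<open>g\<close>. For
  \<open>0 \<le> g \<le> 1\<close> this follows by slicing \<open>g\<close> into closed superlevel sets, on which \<open>M\<close> dominates
  \<open>\<Lambda>\<close>; the slicing error is \<open>1 / n\<close>. An affine change of scale gives the general case.
\<close>
theorem regular_prob_nonneg_on_cone:
  fixes X :: "'a topology" and G :: "('a \<Rightarrow> real) set"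
  assumes X: "compact_space X" "Hausdorff_space X" "topspace X \<noteq> {}"
    and G_cont: "\<And>g. g \<in> G \<Longrightarrow> continuous_map X euclidean g"
    and G0: "(\<lambda>_. 0) \<in> G"
    and G_add: "\<And>g h. g \<in> G \<Longrightarrow> h \<in> G \<Longrightarrow> (\<lambda>z. g z + h z) \<in> G"
    and G_scale: "\<And>g r. g \<in> G \<Longrightarrow> 0 < r \<Longrightarrow> (\<lambda>z. r * g z) \<in> G"
    and G_Sup: "\<And>g. g \<in> G \<Longrightarrow> 0 \<le> (SUP z\<in>topspace X. g z)"
  obtains M where "borel_regular_prob X M" "\<And>g. g \<in> G \<Longrightarrow> 0 \<le> (LINT z|M. g z)"
proof -
  let ?K = "topspace X"
  have cont_bdd: "bounded (g ` ?K)" if "continuous_map X euclidean g" for g :: "'a \<Rightarrow> real"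
  proof -
    have "compact (g ` ?K)"
      using X(1) image_compactin[OF _ that, of ?K] by (simp add: compact_space_def)
    then show ?thesis by (rule compact_imp_bounded)
  qed
  obtain \<Lambda> where \<Lambda>: "mean_on ?K \<Lambda>" and \<Lambda>_G: "\<And>g. g \<in> G \<Longrightarrow> 0 \<le> \<Lambda> g"
    using mean_nonneg_on_cone[OF X(3) cont_bdd[OF G_cont] G0 G_add G_scale G_Sup] by blast
  interpret mean_on ?K \<Lambda> by (rule \<Lambda>)
  have bdd_I: "bounded (h ` ?K)" if "\<And>z. z \<in> ?K \<Longrightarrow> \<bar>h z\<bar> \<le> B" for h :: "'a \<Rightarrow> real" and B
    using that by (auto simp: bounded_iff)
  have bdd_ind: "bounded ((indicator D :: 'a \<Rightarrow> real) ` ?K)" for D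
    by (rule bdd_I[of _ 1]) (simp add: indicator_def)
  have const: "\<Lambda> (\<lambda>_. c) = c" for c
    using scale[of "\<lambda>_. 1" c] one bdd_I[of "\<lambda>_. 1" 1] by simp
  have ind_nonneg: "0 \<le> \<Lambda> (indicator D)" for D
    using mono[of "\<lambda>_. 0" "indicator D"] const[of 0] bdd_ind[of D] bdd_I[of "\<lambda>_. 0" 0] by simp
  define m where "m = (\<lambda>D. ennreal (\<Lambda> (indicator D)))"
  interpret closed_content X m
  proof
    fix C D :: "'a set"
    show "m C \<le> m D" if "C \<subseteq> D"
      unfolding m_def using that
      by (intro ennreal_leI mono bdd_ind) (auto simp: indicator_def)
    have sum: "\<Lambda> (\<lambda>z. indicator C z + indicator D z) = \<Lambda> (indicator C) + \<Lambda> (indicator D)"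
      by (intro add bdd_ind)
    have sum_bdd: "bounded ((\<lambda>z. indicator C z + indicator D z :: real) ` ?K)"
      by (rule bdd_I[of _ 2]) (simp add: indicator_def)
    have "\<Lambda> (indicator (C \<union> D)) \<le> \<Lambda> (\<lambda>z. indicator C z + indicator D z)"
      by (intro mono bdd_ind sum_bdd) (simp add: indicator_def)
    then show "m (C \<union> D) \<le> m C + m D"
      unfolding m_def sum by (simp add: ind_nonneg ennreal_leI flip: ennreal_plus)
    show "m C + m D \<le> m (C \<union> D)" if "C \<inter> D = {}"
    proof -
      have "\<Lambda> (\<lambda>z. indicator C z + indicator D z) \<le> \<Lambda> (indicator (C \<union> D))"
        using that by (intro mono bdd_ind sum_bdd) (auto simp: indicator_def)
      then show ?thesis
        unfolding m_def sum by (simp add: ind_nonneg ennreal_leI flip: ennreal_plus)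
    qed
    have "indicator {} = (\<lambda>_ :: 'a. 0 :: real)" by (simp add: fun_eq_iff)
    then show "m {} = 0" using const[of 0] by (simp add: m_def)
    have "\<Lambda> (indicator ?K) = \<Lambda> (\<lambda>_. 1)"
      by (intro antisym mono bdd_ind bdd_I[of "\<lambda>_. 1" 1]) auto
    then show "m ?K = 1" by (simp add: m_def one)
  qed (use X compact_Hausdorff_or_regular_imp_normal_space in auto)
  define M where "M = reg_measure"
  note M_sets = sets_reg_measure[folded M_def] and M_space = space_reg_measure[folded M_def]
    and M_regular = borel_regular_prob_reg_measure[folded M_def]
  interpret M: prob_space M unfolding M_def by (rule prob_space_reg_measure)
  have integrable: "integrable M g" if "continuous_map X euclidean g" for g :: "'a \<Rightarrow> real"
    using borel_regular_prob_integrable[OF M_regular that cont_bdd[OF that]] .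
  have le_measure: "\<Lambda> (indicator D) \<le> measure M D" if "closedin X D" for D
  proof -
    have "m D = ennreal (\<Lambda> (indicator D))" by (simp only: m_def)
    then have "ennreal (\<Lambda> (indicator D)) \<le> ennreal (measure M D)"
      using content_le_reg_measure[OF that, folded M_def] unfolding M.emeasure_eq_measure by (simp only:)
    then show ?thesis by (simp add: ind_nonneg)
  qed
  have unit: "\<Lambda> \<phi> \<le> (LINT z|M. \<phi> z)"
    if \<phi>: "continuous_map X euclidean \<phi>" and range: "\<And>z. z \<in> ?K \<Longrightarrow> 0 \<le> \<phi> z \<and> \<phi> z \<le> 1" for \<phi>
  proof -
    have "real n * \<Lambda> \<phi> \<le> 1 + n * (LINT z|M. \<phi> z)" for n :: nat
    proof -
      define D where "D = (\<lambda>k. {z \<in> ?K. real k \<le> n * \<phi> z})"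
      have "closedin X {z \<in> ?K. n * \<phi> z \<in> {real k..}}" for k
        by (intro closedin_continuous_map_preimage[where Y = euclidean] continuous_map_real_mult \<phi>) auto
      then have D: "closedin X (D k)" for k by (simp add: D_def)
      have ind_D: "indicator (D k) z = (if real k \<le> n * \<phi> z then 1 else 0 :: real)" if "z \<in> ?K" for k z
        using that by (simp add: D_def)
      have sum: "\<Lambda> (\<lambda>z. \<Sum>k=1..j. indicator (D k) z) = (\<Sum>k=1..j. \<Lambda> (indicator (D k)))
          \<and> bounded ((\<lambda>z. \<Sum>k=1..j. indicator (D k) z :: real) ` ?K)" for j
      proof (induction j)
        case 0
        show ?case using const[of 0] bdd_I[of "\<lambda>_. 0" 0] by simp
      next
        case (Suc j)
        then show ?case
          using add[of "\<lambda>z. \<Sum>k=1..j. indicator (D k) z" "indicator (D (Suc j))"] bdd_ind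
            bounded_plus_comp[of "\<lambda>z. \<Sum>k=1..j. indicator (D k) z :: real" ?K "indicator (D (Suc j))"]
          by simp
      qed
      have "real n * \<Lambda> \<phi> = \<Lambda> (\<lambda>z. n * \<phi> z)"
        by (rule scale[symmetric, OF cont_bdd[OF \<phi>]])
      also have "\<dots> \<le> \<Lambda> (\<lambda>z. 1 + (\<Sum>k=1..n. indicator (D k) z))"
      proof (rule mono)
        show "bounded ((\<lambda>z. n * \<phi> z) ` ?K)"
          by (intro cont_bdd continuous_map_real_mult \<phi>) auto
        show "bounded ((\<lambda>z. 1 + (\<Sum>k=1..n. indicator (D k) z :: real)) ` ?K)"
          using sum[of n] by (intro bounded_plus_comp bdd_I[of "\<lambda>_. 1" 1]) auto
        show "n * \<phi> z \<le> 1 + (\<Sum>k=1..n. indicator (D k) z)" if "z \<in> ?K" for z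
          using layer_sum(2)[of "\<phi> z" n] range[OF that] that by (simp add: ind_D)
      qed
      also have "\<dots> = 1 + (\<Sum>k=1..n. \<Lambda> (indicator (D k)))"
        using sum[of n] one by (subst add) (auto intro: bdd_I[of "\<lambda>_. 1" 1])
      also have "\<dots> \<le> 1 + (\<Sum>k=1..n. measure M (D k))"
        using D by (intro add_left_mono sum_mono le_measure)
      also have "(\<Sum>k=1..n. measure M (D k)) = (LINT z|M. (\<Sum>k=1..n. indicator (D k) z))"
        using D by (subst Bochner_Integration.integral_sum)
          (auto simp: M_sets closed_borel M.emeasure_eq_measure)
      also have "\<dots> \<le> (LINT z|M. n * \<phi> z)"
      proof (rule integral_mono)
        show "integrable M (\<lambda>z. \<Sum>k=1..n. indicator (D k) z :: real)"
          using D by (auto simp: M_sets closed_borel M.emeasure_eq_measure)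
        show "integrable M (\<lambda>z. n * \<phi> z)" using integrable[OF \<phi>] by simp
        show "(\<Sum>k=1..n. indicator (D k) z) \<le> n * \<phi> z" if "z \<in> space M" for z
          using layer_sum(1)[of "\<phi> z" n] range[of z] that by (simp add: ind_D M_space)
      qed
      finally show ?thesis by simp
    qed
    then have *: "real n * (\<Lambda> \<phi> - (LINT z|M. \<phi> z)) \<le> 1" for n :: nat
      by (simp add: algebra_simps)
    show ?thesis
    proof (rule ccontr)
      assume "\<not> ?thesis"
      then obtain n :: nat where "1 < real n * (\<Lambda> \<phi> - (LINT z|M. \<phi> z))"
        using reals_Archimedean3[of "\<Lambda> \<phi> - (LINT z|M. \<phi> z)"] by auto
      with *[of n] show False by simp
    qed
  qed
  have le_integral: "\<Lambda> g \<le> (LINT z|M. g z)" if g: "continuous_map X euclidean g" for g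
  proof -
    obtain B where B: "0 < B" "\<And>z. z \<in> ?K \<Longrightarrow> \<bar>g z\<bar> \<le> B"
      using cont_bdd[OF g] by (auto simp: bounded_pos)
    \<comment> \<open>\<open>g\<close> takes values in \<open>[-B, B]\<close>, which is mapped onto \<open>[0, 1]\<close>.\<close>
    define \<phi> where "\<phi> = (\<lambda>z. 1 / 2 + 1 / (2 * B) * g z)"
    have \<phi>: "continuous_map X euclidean \<phi>"
      unfolding \<phi>_def by (intro continuous_map_add continuous_map_real_mult g) auto
    have "0 \<le> \<phi> z \<and> \<phi> z \<le> 1" if "z \<in> ?K" for z
      using B(2)[OF that] B(1) by (auto simp: \<phi>_def field_simps abs_le_iff)
    with \<phi> have "\<Lambda> \<phi> \<le> (LINT z|M. \<phi> z)" by (rule unit)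
    moreover have "\<Lambda> \<phi> = 1 / 2 + 1 / (2 * B) * \<Lambda> g"
    proof -
      have "bounded ((\<lambda>z. 1 / (2 * B) * g z) ` ?K)"
        by (intro cont_bdd continuous_map_real_mult g) auto
      then have "\<Lambda> \<phi> = \<Lambda> (\<lambda>_. 1 / 2) + \<Lambda> (\<lambda>z. 1 / (2 * B) * g z)"
        unfolding \<phi>_def by (intro add bdd_I[of "\<lambda>_. 1 / 2" "1 / 2"]) simp_all
      then show ?thesis by (simp only: const scale[OF cont_bdd[OF g]])
    qed
    moreover have "(LINT z|M. \<phi> z) = 1 / 2 + 1 / (2 * B) * (LINT z|M. g z)"
      unfolding \<phi>_def using integrable[OF g] by (subst Bochner_Integration.integral_add)
        (auto simp: M.prob_space)
    ultimately show ?thesis using B(1) by (simp add: divide_le_cancel)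
  qed
  show thesis
  proof (rule that)
    show "borel_regular_prob X M" by (rule M_regular)
    show "0 \<le> (LINT z|M. g z)" if "g \<in> G" for g
      using \<Lambda>_G[OF that] le_integral[OF G_cont[OF that]] by linarith
  qed
qed

section \<open>Duality of finite sequence norms\<close>

lemma Holder_inequality_sum:
  fixes a b :: "'i \<Rightarrow> real" and p q :: real
  assumes pq: "1 < p" "1 < q" "1 / p + 1 / q = 1"
    and a: "\<And>i. i \<in> I \<Longrightarrow> 0 \<le> a i" and b: "\<And>i. i \<in> I \<Longrightarrow> 0 \<le> b i"
  shows "(\<Sum>i\<in>I. a i * b i) \<le> (\<Sum>i\<in>I. a i powr p) powr (1 / p) * (\<Sum>i\<in>I. b i powr q) powr (1 / q)"
proof (cases "finite I")
  case I: True
  define S T where "S = (\<Sum>i\<in>I. a i powr p)" and "T = (\<Sum>i\<in>I. b i powr q)"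
  have ST: "0 \<le> S" "0 \<le> T" by (simp_all add: S_def T_def sum_nonneg)
  show ?thesis
  proof (cases "S = 0 \<or> T = 0")
    case True
    then have "a i * b i = 0" if "i \<in> I" for i
      using I that unfolding S_def T_def by (auto simp: sum_nonneg_eq_0_iff)
    then have "(\<Sum>i\<in>I. a i * b i) = 0" by (intro sum.neutral ballI)
    then show ?thesis by simp
  next
    case False
    with ST have pos: "0 < S" "0 < T" by auto
    define s t where "s = S powr (1 / p)" and "t = T powr (1 / q)"
    have st: "0 < s" "0 < t" "s powr p = S" "t powr q = T"
      using pos pq by (simp_all add: s_def t_def powr_powr)
    have "(\<Sum>i\<in>I. a i * b i) / (s * t) = (\<Sum>i\<in>I. (a i / s) * (b i / t))"
      by (simp add: sum_divide_distrib)
    also have "\<dots> \<le> (\<Sum>i\<in>I. (a i / s) powr p / p + (b i / t) powr q / q)"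
      using a b pq st by (intro sum_mono Youngs_inequality) auto
    also have "\<dots> = (\<Sum>i\<in>I. a i powr p) / S / p + (\<Sum>i\<in>I. b i powr q) / T / q"
      using a b st by (simp add: powr_divide sum.distrib sum_divide_distrib)
    also have "\<dots> = 1" using pos pq(3) by (simp flip: S_def T_def)
    finally show ?thesis using st by (simp add: s_def t_def S_def T_def divide_le_eq)
  qed
qed simp

lemma conj_index_PInf: "conj_index \<infinity> = 1"
  by (simp add: conj_index_def)

lemma conj_index_real:
  assumes "1 < r"
  shows "1 < conj_index (ereal r)" "1 / r + 1 / conj_index (ereal r) = 1"
    and "(conj_index (ereal r) - 1) * r = conj_index (ereal r)"
  using assms by (simp_all add: conj_index_def field_simps)

lemma conj_index_ge_1:
  assumes "1 < p"
  shows "1 \<le> conj_index p"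
proof (cases p)
  case (real r)
  with assms have "1 < r" by simp
  from conj_index_real(1)[OF this] show ?thesis by (simp add: real)
qed (use assms in \<open>simp_all add: conj_index_PInf\<close>)

lemma lp_norm_nonneg:
  assumes "0 < n"
  shows "0 \<le> lp_norm p n l"
proof -
  have "0 \<le> cmod (l n)" by simp
  also have "\<dots> \<le> Max ((\<lambda>i. cmod (l i)) ` {1..n})" using assms by (intro Max_ge) auto
  finally show ?thesis by (simp add: lp_norm_def)
qed

lemma lp_norm_Holder:
  assumes "1 < p" "0 < n" and b: "\<And>i. i \<in> {1..n} \<Longrightarrow> 0 \<le> b i"
  shows "(\<Sum>i=1..n. cmod (l i) * b i)
    \<le> lp_norm p n l * (\<Sum>i=1..n. b i powr conj_index p) powr (1 / conj_index p)"
proof (cases p)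
  case (real r)
  with assms(1) have r: "1 < r" by simp
  show ?thesis
    using Holder_inequality_sum[OF r conj_index_real(1,2)[OF r], of "{1..n}" "\<lambda>i. cmod (l i)" b] b
    by (simp add: real lp_norm_def)
next
  case PInf
  have "(\<Sum>i=1..n. cmod (l i) * b i) \<le> (\<Sum>i=1..n. lp_norm p n l * b i)"
    using b by (intro sum_mono mult_right_mono) (auto simp: PInf lp_norm_def)
  also have "\<dots> = lp_norm p n l * (\<Sum>i=1..n. b i powr 1) powr 1"
    using b sum_nonneg[of "{1..n}" b] by (simp add: sum_distrib_left)
  finally show ?thesis by (simp add: PInf conj_index_PInf)
qed (use assms in auto)

text \<open>
  The converse of Hoelder's inequality. It turns the Cohen inequality, which holds for all weights
  \<open>l\<close>, into an inequality between \<open>q\<close>-th powers that no longer mentions \<open>l\<close>.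
\<close>
lemma lp_norm_dual:
  assumes "1 < p" "0 < n" and b: "\<And>i. i \<in> {1..n} \<Longrightarrow> 0 \<le> b i" and W: "0 \<le> W"
    and bound: "\<And>l. (\<Sum>i=1..n. cmod (l i) * b i) \<le> W * lp_norm p n l"
  shows "(\<Sum>i=1..n. b i powr conj_index p) \<le> W powr conj_index p"
proof (cases p)
  case (real r)
  with assms(1) have r: "1 < r" by simp
  define q where "q = conj_index p"
  have q: "1 < q" "1 / r + 1 / q = 1" "(q - 1) * r = q"
    using conj_index_real[OF r] by (simp_all add: q_def real)
  define S where "S = (\<Sum>i=1..n. b i powr q)"
  have S: "0 \<le> S" by (simp add: S_def sum_nonneg)
  \<comment> \<open>The weights for which Hoelder's inequality is an equality.\<close>
  let ?l = "\<lambda>i. complex_of_real (b i powr (q - 1))"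
  have "S = (\<Sum>i=1..n. cmod (?l i) * b i)"
    unfolding S_def
  proof (rule sum.cong)
    show "b i powr q = cmod (?l i) * b i" if "i \<in> {1..n}" for i
      using b[OF that] powr_mult_base[of "b i" "q - 1"] by (simp add: mult.commute)
  qed simp
  also have "\<dots> \<le> W * lp_norm p n ?l" by (rule bound)
  also have "lp_norm p n ?l = S powr (1 / r)"
    by (simp add: lp_norm_def real powr_powr q(3) S_def)
  finally have le: "S \<le> W * S powr (1 / r)" .
  show ?thesis
  proof (cases "S = 0")
    case False
    with S have S: "0 < S" by simp
    have "S powr (1 / r) * S powr (1 / q) = S"
      using S q(2) by (simp flip: powr_add)
    with le have "S powr (1 / r) * S powr (1 / q) \<le> S powr (1 / r) * W"
      by (simp add: mult.commute)
    with S have "S powr (1 / q) \<le> W" by (simp add: mult_le_cancel_left_pos)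
    then have "(S powr (1 / q)) powr q \<le> W powr q"
      using q by (intro powr_mono2) auto
    then show ?thesis using S q by (simp add: powr_powr q_def S_def)
  qed (use W in \<open>simp add: S_def q_def\<close>)
next
  case PInf
  have "{1..n} \<noteq> {}" using assms(2) by simp
  then have "lp_norm p n (\<lambda>_. 1) = 1" by (simp add: lp_norm_def PInf)
  with bound[of "\<lambda>_. 1"] show ?thesis
    using b W by (simp add: PInf conj_index_PInf)
qed (use assms in auto)

section \<open>Weak norms and integrals over the ball of the bidual\<close>

lemma cmod_apply_bidual_le: "z \<in> cball 0 1 \<Longrightarrow> cmod (cdual_apply z y) \<le> norm y"
  using cdual_in_cball_iff by blast

lemma weak_lq_norm_upper:
  fixes y :: "nat \<Rightarrow> 'f::complex_normed_vector cdual"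
  assumes q: "1 \<le> q" and z: "z \<in> cball 0 1"
  shows "(\<Sum>i=1..n. cmod (cdual_apply z (y i)) powr q) powr (1 / q) \<le> weak_lq_norm q n y"
  unfolding weak_lq_norm_def
proof (rule cSUP_upper[OF z])
  show "bdd_above ((\<lambda>z. (\<Sum>i=1..n. cmod (cdual_apply z (y i)) powr q) powr (1 / q)) ` cball 0 1)"
  proof (rule bdd_aboveI2)
    fix z :: "'f cdual cdual" assume "z \<in> cball 0 1"
    then show "(\<Sum>i=1..n. cmod (cdual_apply z (y i)) powr q) powr (1 / q)
        \<le> (\<Sum>i=1..n. norm (y i) powr q) powr (1 / q)"
      using q by (intro powr_mono2 sum_mono sum_nonneg cmod_apply_bidual_le) auto
  qed
qed

lemma weak_lq_norm_nonneg: "1 \<le> q \<Longrightarrow> 0 \<le> weak_lq_norm q n y"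
  by (rule order_trans[OF _ weak_lq_norm_upper[of _ 0]]) auto

lemma weak_lq_norm_powr_upper:
  assumes "1 \<le> q" "z \<in> cball 0 1"
  shows "(\<Sum>i=1..n. cmod (cdual_apply z (y i)) powr q) \<le> weak_lq_norm q n y powr q"
proof -
  have "((\<Sum>i=1..n. cmod (cdual_apply z (y i)) powr q) powr (1 / q)) powr q \<le> weak_lq_norm q n y powr q"
    using assms weak_lq_norm_upper by (intro powr_mono2) auto
  then show ?thesis using assms by (simp add: powr_powr sum_nonneg)
qed

lemma weak_lq_norm_powr_least:
  fixes y :: "nat \<Rightarrow> 'f::complex_normed_vector cdual"
  assumes q: "1 \<le> q"
    and le: "\<And>z :: 'f cdual cdual. z \<in> cball 0 1 \<Longrightarrow> (\<Sum>i=1..n. cmod (cdual_apply z (y i)) powr q) \<le> b"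
  shows "weak_lq_norm q n y powr q \<le> b"
proof -
  have b: "0 \<le> b" using le[of 0] by (rule order_trans[rotated]) (auto intro: sum_nonneg)
  have "weak_lq_norm q n y \<le> b powr (1 / q)"
    unfolding weak_lq_norm_def using q by (intro cSUP_least powr_mono2 le sum_nonneg) auto
  then have "weak_lq_norm q n y powr q \<le> (b powr (1 / q)) powr q"
    using q by (intro powr_mono2 weak_lq_norm_nonneg) auto
  then show ?thesis using q b by (simp add: powr_powr)
qed

lemma topspace_bidual_ball: "topspace bidual_ball = cball 0 1"
  by (simp add: bidual_ball_eq topspace_dual_ball)

lemma continuous_map_cmod_powr:
  assumes "1 \<le> q"
  shows "continuous_map bidual_ball euclidean (\<lambda>z. cmod (cdual_apply z y) powr q)"
proof -
  have "continuous_on UNIV (\<lambda>w. cmod w powr q)"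
    using assms by (intro continuous_on_powr' continuous_intros) auto
  then have "continuous_map euclidean euclidean (\<lambda>w. cmod w powr q)" by simp
  from continuous_map_compose[OF continuous_map_eval_dual_ball this]
  show ?thesis by (simp add: bidual_ball_eq o_def)
qed

lemma integrable_cmod_powr:
  fixes y :: "'f::complex_normed_vector cdual"
  assumes q: "1 \<le> q" and M: "borel_regular_prob bidual_ball M"
  shows "integrable M (\<lambda>z. cmod (cdual_apply z y) powr q)"
proof (rule borel_regular_prob_integrable[OF M continuous_map_cmod_powr[OF q]])
  show "bounded ((\<lambda>z. cmod (cdual_apply z y) powr q) ` topspace bidual_ball)"
    unfolding bounded_iff using q
    by (auto simp: topspace_bidual_ball intro!: exI[of _ "norm y powr q"] powr_mono2 cmod_apply_bidual_le)
qed

lemma Lq_norm_nonneg: "0 \<le> Lq_norm q M y"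
  by (simp add: Lq_norm_def)

lemma Lq_norm_powr: "1 \<le> q \<Longrightarrow> Lq_norm q M y powr q = (LINT z|M. cmod (cdual_apply z y) powr q)"
  by (simp add: Lq_norm_def powr_powr)

section \<open>The domination theorem\<close>

text \<open>
  Hoelder's inequality for the weights, followed by \<open>\<integral> \<Sum>\<bar>z y\<^sub>i\<bar>\<^sup>q d\<mu> \<le> sup \<Sum>\<bar>z y\<^sub>i\<bar>\<^sup>q\<close>,
  which holds because \<open>\<mu>\<close> is a probability measure on the ball.
\<close>
theorem dominated_imp_cohen_constant:
  fixes f :: "'e \<Rightarrow> 'f::complex_normed_vector"
  assumes p: "1 < p" and C: "0 \<le> C"
    and M: "borel_regular_prob bidual_ball M" and dom: "dominated_by p U f C M"
  shows "C \<in> cohen_constants p U f"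
proof -
  define q where "q = conj_index p"
  have q: "1 \<le> q" using conj_index_ge_1[OF p] by (simp add: q_def)
  interpret prob_space M using M by (simp add: borel_regular_prob_def)
  have "(\<Sum>i=1..n. cmod (l i) * cmod (cdual_apply (y i) (f (x i)))) \<le> C * lp_norm p n l * weak_lq_norm q n y"
    if n: "0 < n" and x: "\<forall>i\<in>{1..n}. x i \<in> U" for n l x and y :: "nat \<Rightarrow> 'f cdual"
  proof -
    have "(\<Sum>i=1..n. Lq_norm q M (y i) powr q) = (LINT z|M. (\<Sum>i=1..n. cmod (cdual_apply z (y i)) powr q))"
      using q M by (subst Bochner_Integration.integral_sum) (auto simp: Lq_norm_powr integrable_cmod_powr)
    also have "\<dots> \<le> (LINT z|M. weak_lq_norm q n y powr q)"
      using q M by (intro integral_mono Bochner_Integration.integrable_sum integrable_cmod_powr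
          integrable_const weak_lq_norm_powr_upper)
        (auto simp: space_borel_regular_prob topspace_bidual_ball)
    also have "\<dots> = weak_lq_norm q n y powr q" by (simp add: prob_space)
    finally have "(\<Sum>i=1..n. Lq_norm q M (y i) powr q) powr (1 / q) \<le> (weak_lq_norm q n y powr q) powr (1 / q)"
      using q by (intro powr_mono2 sum_nonneg) auto
    also have "\<dots> = weak_lq_norm q n y"
      using q weak_lq_norm_nonneg[OF q, of n y] by (simp add: powr_powr)
    finally have weak: "(\<Sum>i=1..n. Lq_norm q M (y i) powr q) powr (1 / q) \<le> weak_lq_norm q n y" .
    have "(\<Sum>i=1..n. cmod (l i) * cmod (cdual_apply (y i) (f (x i))))
        \<le> (\<Sum>i=1..n. cmod (l i) * (C * Lq_norm q M (y i)))"
      using dom x by (intro sum_mono mult_left_mono) (auto simp: dominated_by_def q_def)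
    also have "\<dots> = C * (\<Sum>i=1..n. cmod (l i) * Lq_norm q M (y i))"
      by (simp add: sum_distrib_left mult_ac)
    also have "(\<Sum>i=1..n. cmod (l i) * Lq_norm q M (y i))
        \<le> lp_norm p n l * (\<Sum>i=1..n. Lq_norm q M (y i) powr q) powr (1 / q)"
      unfolding q_def by (intro lp_norm_Holder p n Lq_norm_nonneg)
    also have "\<dots> \<le> lp_norm p n l * weak_lq_norm q n y"
      by (intro mult_left_mono weak lp_norm_nonneg n)
    finally show ?thesis using C by (simp add: mult_left_mono mult.assoc)
  qed
  then show ?thesis using C by (simp add: cohen_constants_def q_def)
qed

text \<open>
  The functions \<open>z \<mapsto> C\<^sup>q \<bar>z y\<bar>\<^sup>q - \<bar>y (f x)\<bar>\<^sup>q\<close> generate a cone: sums correspond to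
  concatenated lists of pairs \<open>(x, y)\<close>, and a positive factor \<open>r\<close> is absorbed by replacing \<open>y\<close> with
  \<open>r\<^sup>1\<^sup>/\<^sup>q y\<close>. The Cohen inequality, freed of its weights by duality, says that no function of the cone
  has a negative supremum. A regular probability measure with nonnegative integral on the cone is
  the required one.
\<close>
theorem cohen_constant_imp_dominated:
  fixes f :: "'e \<Rightarrow> 'f::complex_normed_vector"
  assumes p: "1 < p" and C: "C \<in> cohen_constants p U f"
  obtains M where "borel_regular_prob bidual_ball M" "dominated_by p U f C M"
proof -
  define q where "q = conj_index p"
  have q: "1 \<le> q" using conj_index_ge_1[OF p] by (simp add: q_def)
  have C0: "0 \<le> C" using C by (simp add: cohen_constants_def)
  define e where "e = (\<lambda>(x, y) z. C powr q * cmod (cdual_apply z y) powr q - cmod (cdual_apply y (f x)) powr q)"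
  define G where "G = {\<lambda>z :: 'f cdual cdual. \<Sum>xy\<leftarrow>xys. e xy z |xys. \<forall>xy\<in>set xys. fst xy \<in> U}"
  have G_I: "(\<lambda>z. \<Sum>xy\<leftarrow>xys. e xy z) \<in> G" if "\<forall>xy\<in>set xys. fst xy \<in> U" for xys
    using that unfolding G_def by blast
  obtain M where M: "borel_regular_prob bidual_ball M" and nonneg: "\<And>g. g \<in> G \<Longrightarrow> 0 \<le> (LINT z|M. g z)"
  proof (rule regular_prob_nonneg_on_cone[where X = bidual_ball and G = G])
    show "compact_space (bidual_ball :: 'f cdual cdual topology)" "Hausdorff_space (bidual_ball :: 'f cdual cdual topology)"
      by (simp_all add: bidual_ball_eq Banach_Alaoglu Hausdorff_dual_ball)
    show "topspace (bidual_ball :: 'f cdual cdual topology) \<noteq> {}"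
      by (simp add: topspace_bidual_ball)
    show "continuous_map bidual_ball euclidean g" if "g \<in> G" for g
    proof -
      have e: "continuous_map bidual_ball euclidean (e xy)" for xy
        unfolding e_def split_def using q
        by (intro continuous_map_diff continuous_map_real_mult continuous_map_cmod_powr) auto
      have "continuous_map bidual_ball euclidean (\<lambda>z. \<Sum>xy\<leftarrow>xys. e xy z)" for xys
        by (induction xys) (auto intro: continuous_map_add e)
      with that show ?thesis unfolding G_def by blast
    qed
    show "(\<lambda>_. 0) \<in> G" using G_I[of "[]"] by simp
    show "(\<lambda>z. g z + h z) \<in> G" if "g \<in> G" "h \<in> G" for g h
    proof -
      from that obtain xys xys' where
        "g = (\<lambda>z. \<Sum>xy\<leftarrow>xys. e xy z)" "\<forall>xy\<in>set xys. fst xy \<in> U"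
        "h = (\<lambda>z. \<Sum>xy\<leftarrow>xys'. e xy z)" "\<forall>xy\<in>set xys'. fst xy \<in> U"
        unfolding G_def by blast
      then show ?thesis using G_I[of "xys @ xys'"] by auto
    qed
    show "(\<lambda>z. r * g z) \<in> G" if g: "g \<in> G" and r: "0 < r" for g r
    proof -
      from g obtain xys where xys: "g = (\<lambda>z. \<Sum>xy\<leftarrow>xys. e xy z)" "\<forall>xy\<in>set xys. fst xy \<in> U"
        unfolding G_def by blast
      define s where "s = r powr (1 / q)"
      have s: "0 \<le> s" "s powr q = r" using r q by (simp_all add: s_def powr_powr)
      define scaled where "scaled = map (\<lambda>(x, y). (x, s *\<^sub>R y)) xys"
      have "e (x, s *\<^sub>R y) z = r * e (x, y) z" for x y z
        using s by (simp add: e_def cdual_apply_scaleR scaleR_cdual.rep_eq norm_mult powr_mult algebra_simps)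
      then have "(\<lambda>z. r * g z) = (\<lambda>z. \<Sum>xy\<leftarrow>scaled. e xy z)"
        by (simp add: xys(1) scaled_def sum_list_const_mult o_def split_def)
      moreover have "\<forall>xy\<in>set scaled. fst xy \<in> U"
        using xys(2) by (auto simp: scaled_def)
      ultimately show ?thesis using G_I by simp
    qed
    show "0 \<le> (SUP z\<in>topspace bidual_ball. g z)" if g: "g \<in> G" for g
    proof -
      from g obtain xys where xys: "g = (\<lambda>z. \<Sum>xy\<leftarrow>xys. e xy z)" "\<forall>xy\<in>set xys. fst xy \<in> U"
        unfolding G_def by blast
      define n where "n = length xys"
      define x y where "x = (\<lambda>i. fst (xys ! (i - 1)))" and "y = (\<lambda>i. snd (xys ! (i - 1)))"
      define b where "b = (\<lambda>i. cmod (cdual_apply (y i) (f (x i))))"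
      define T where "T = (\<lambda>z :: 'f cdual cdual. \<Sum>i=1..n. cmod (cdual_apply z (y i)) powr q)"
      have x: "x i \<in> U" if "i \<in> {1..n}" for i
        using that xys(2) nth_mem[of "i - 1" xys] by (auto simp: n_def x_def)
      have g_eq: "g z = C powr q * T z - (\<Sum>i=1..n. b i powr q)" for z
      proof -
        have "g z = (\<Sum>i=0..<n. e (xys ! i) z)"
          by (simp add: xys(1) sum_list_sum_nth n_def)
        also have "\<dots> = (\<Sum>i=1..n. e (xys ! (i - 1)) z)"
          by (rule sum.reindex_bij_witness[of _ "\<lambda>i. i - 1" Suc]) auto
        also have "\<dots> = (\<Sum>i=1..n. C powr q * cmod (cdual_apply z (y i)) powr q - b i powr q)"
          by (simp add: e_def x_def y_def b_def split_def)
        finally show ?thesis by (simp add: T_def sum_subtractf sum_distrib_left)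
      qed
      have T_le: "T z \<le> weak_lq_norm q n y powr q" if "z \<in> cball 0 1" for z
        unfolding T_def by (rule weak_lq_norm_powr_upper[OF q that])
      define s where "s = (SUP z\<in>cball 0 1. g z)"
      have "bdd_above (g ` cball 0 1)"
      proof (rule bdd_aboveI2)
        fix z :: "'f cdual cdual" assume "z \<in> cball 0 1"
        then have "C powr q * T z \<le> C powr q * weak_lq_norm q n y powr q"
          by (intro mult_left_mono T_le) auto
        moreover have "0 \<le> (\<Sum>i=1..n. b i powr q)" by (simp add: sum_nonneg)
        ultimately show "g z \<le> C powr q * weak_lq_norm q n y powr q" unfolding g_eq by linarith
      qed
      then have upper: "C powr q * T z \<le> s + (\<Sum>i=1..n. b i powr q)" if "z \<in> cball 0 1" for z
        using cSUP_upper[OF that, of g] g_eq[of z] by (simp add: s_def)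
      have "(\<Sum>i=1..n. b i powr q) \<le> C powr q * weak_lq_norm q n y powr q"
      proof (cases "n = 0")
        case False
        have "(\<Sum>i=1..n. b i powr q) \<le> (C * weak_lq_norm q n y) powr q"
          unfolding q_def
        proof (rule lp_norm_dual[OF p])
          show "(\<Sum>i=1..n. cmod (l i) * b i) \<le> C * weak_lq_norm (conj_index p) n y * lp_norm p n l" for l
            using C x False by (auto simp: cohen_constants_def b_def mult_ac)
        qed (use False C0 weak_lq_norm_nonneg[OF q, of n y] in \<open>auto simp: b_def simp flip: q_def\<close>)
        then show ?thesis by (simp add: powr_mult C0 weak_lq_norm_nonneg q)
      qed simp
      \<comment> \<open>For \<open>C = 0\<close> the bound \<open>upper\<close> cannot be divided by \<open>C powr q\<close>, but any point of the ball serves.\<close>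
      also have "\<dots> \<le> s + (\<Sum>i=1..n. b i powr q)"
      proof (cases "C = 0")
        case True
        then show ?thesis using upper[of 0] by simp
      next
        case False
        with C0 have "0 < C powr q" by simp
        moreover from this have "weak_lq_norm q n y powr q \<le> (s + (\<Sum>i=1..n. b i powr q)) / C powr q"
          using upper by (intro weak_lq_norm_powr_least q) (simp add: T_def field_simps)
        ultimately show ?thesis by (simp add: field_simps)
      qed
      finally show ?thesis by (simp add: s_def topspace_bidual_ball)
    qed
  qed (rule that)
  have "cmod (cdual_apply y (f x)) \<le> C * Lq_norm q M y" if x: "x \<in> U" for x y
  proof -
    interpret prob_space M using M by (simp add: borel_regular_prob_def)
    have "(\<lambda>z. e (x, y) z) \<in> G" using G_I[of "[(x, y)]"] x by simp
    then have "0 \<le> (LINT z|M. e (x, y) z)" by (rule nonneg)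
    also have "\<dots> = C powr q * Lq_norm q M y powr q - cmod (cdual_apply y (f x)) powr q"
      using integrable_cmod_powr[OF q M, of y] q by (simp add: e_def Lq_norm_powr prob_space)
    finally have "cmod (cdual_apply y (f x)) powr q \<le> (C * Lq_norm q M y) powr q"
      by (simp add: powr_mult C0 Lq_norm_nonneg)
    then show ?thesis
      using q C0 Lq_norm_nonneg[of q M y] powr_less_mono2[of q "C * Lq_norm q M y" "cmod (cdual_apply y (f x))"]
      by (smt (verit) mult_nonneg_nonneg)
  qed
  with M show thesis by (intro that) (auto simp: dominated_by_def q_def)
qed

section \<open>The least Cohen constant\<close>

text \<open>
  The infimum of the constants is attained, since each inequality defining them survives passage to
  the infimum.
\<close>
lemma cohen_norm_mem:
  fixes f :: "'e \<Rightarrow> 'f::complex_normed_vector"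
  assumes p: "1 < p" and "cohen_constants p U f \<noteq> {}"
  shows "cohen_norm p U f \<in> cohen_constants p U f"
  unfolding cohen_constants_def
proof (intro CollectI conjI allI impI)
  let ?A = "cohen_constants p U f"
  show "0 \<le> cohen_norm p U f"
    unfolding cohen_norm_def using assms(2) by (intro cInf_greatest) (auto simp: cohen_constants_def)
  fix n :: nat and l x and y :: "nat \<Rightarrow> 'f cdual"
  assume n: "0 < n" and x: "\<forall>i\<in>{1..n}. x i \<in> U"
  define S where "S = (\<Sum>i=1..n. cmod (l i) * cmod (cdual_apply (y i) (f (x i))))"
  define N where "N = lp_norm p n l * weak_lq_norm (conj_index p) n y"
  have N: "0 \<le> N"
    unfolding N_def by (intro mult_nonneg_nonneg lp_norm_nonneg n weak_lq_norm_nonneg conj_index_ge_1 p)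
  have le: "S \<le> C * N" if "C \<in> ?A" for C
    using that n x by (simp add: cohen_constants_def S_def N_def mult.assoc)
  have "S \<le> cohen_norm p U f * N"
  proof (cases "N = 0")
    case True
    then show ?thesis using le assms(2) by auto
  next
    case False
    with N have "0 < N" by simp
    then have "S / N \<le> C" if "C \<in> ?A" for C using le[OF that] by (simp add: field_simps)
    then have "S / N \<le> cohen_norm p U f"
      unfolding cohen_norm_def using assms(2) by (intro cInf_greatest)
    with \<open>0 < N\<close> show ?thesis by (simp add: field_simps)
  qed
  then show "(\<Sum>i=1..n. cmod (l i) * cmod (cdual_apply (y i) (f (x i))))
      \<le> cohen_norm p U f * lp_norm p n l * weak_lq_norm (conj_index p) n y"
    by (simp add: S_def N_def mult.assoc)
qed

lemma cohen_norm_le: "C \<in> cohen_constants p U f \<Longrightarrow> cohen_norm p U f \<le> C"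
  unfolding cohen_norm_def by (rule cInf_lower) (auto simp: cohen_constants_def intro!: bdd_belowI[of _ 0])

lemma cohen_constants_eq_dominated:
  fixes f :: "'e \<Rightarrow> 'f::complex_normed_vector"
  assumes "1 < p"
  shows "cohen_constants p U f
    = {C. 0 \<le> C \<and> (\<exists>M. borel_regular_prob bidual_ball M \<and> dominated_by p U f C M)}"
proof (intro equalityI subsetI)
  fix C assume C: "C \<in> cohen_constants p U f"
  then have "0 \<le> C" by (simp add: cohen_constants_def)
  moreover obtain M where "borel_regular_prob bidual_ball M" "dominated_by p U f C M"
    using cohen_constant_imp_dominated[OF assms C] .
  ultimately show "C \<in> {C. 0 \<le> C \<and> (\<exists>M. borel_regular_prob bidual_ball M \<and> dominated_by p U f C M)}"
    by blast
next
  fix C assume "C \<in> {C. 0 \<le> C \<and> (\<exists>M. borel_regular_prob bidual_ball M \<and> dominated_by p U f C M)}"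
  then show "C \<in> cohen_constants p U f"
    using dominated_imp_cohen_constant[OF assms] by blast
qed

text \<open>
  The constant ranges over all reals because it will be the infimum of the Cohen constants, and
  for an empty set of constants that infimum is an unspecified real number.
\<close>
definition cohen_inequality :: "ereal \<Rightarrow> 'e set \<Rightarrow> ('e \<Rightarrow> 'f::complex_normed_vector) \<Rightarrow> real \<Rightarrow> bool"
  where "cohen_inequality p U f C \<longleftrightarrow>
    (\<forall>(n::nat) l x y. 0 < n \<longrightarrow> (\<forall>i\<in>{1..n}. x i \<in> U) \<longrightarrow>
      cmod (\<Sum>i=1..n. l i * cdual_apply (y i) (f (x i)))
        \<le> C * lp_norm p n l * weak_lq_norm (conj_index p) n y)"

lemma cohen_constant_imp_inequality:
  assumes "C \<in> cohen_constants p U f"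
  shows "cohen_inequality p U f C"
  unfolding cohen_inequality_def
proof (intro allI impI)
  fix n :: nat and l x y
  assume "0 < n" "\<forall>i\<in>{1..n}. x i \<in> U"
  then have "(\<Sum>i=1..n. cmod (l i) * cmod (cdual_apply (y i) (f (x i))))
      \<le> C * lp_norm p n l * weak_lq_norm (conj_index p) n y"
    using assms by (simp add: cohen_constants_def)
  moreover have "cmod (\<Sum>i=1..n. l i * cdual_apply (y i) (f (x i)))
      \<le> (\<Sum>i=1..n. cmod (l i) * cmod (cdual_apply (y i) (f (x i))))"
    by (rule sum_norm_le) (simp add: norm_mult)
  ultimately show "cmod (\<Sum>i=1..n. l i * cdual_apply (y i) (f (x i)))
      \<le> C * lp_norm p n l * weak_lq_norm (conj_index p) n y"
    by (rule order_trans[rotated])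
qed

text \<open>
  Rotating each weight \<open>l i\<close> by the phase that makes its summand nonnegative leaves \<open>lp_norm\<close>
  unchanged and turns the modulus of the sum into the sum of the moduli. The factor 1 is used where
  the summand vanishes, since \<open>sgn 0 = 0\<close> would change the norm.
\<close>
lemma cohen_inequality_imp_constant:
  assumes p: "1 < p" and C: "cohen_inequality p U f C"
  shows "max 0 C \<in> cohen_constants p U f"
  unfolding cohen_constants_def
proof (intro CollectI conjI allI impI)
  fix n :: nat and l x y
  assume n: "0 < n" and x: "\<forall>i\<in>{1..n}. x i \<in> U"
  define c where "c = (\<lambda>i. cdual_apply (y i) (f (x i)))"
  define l' where "l' = (\<lambda>i. cmod (l i) * (if c i = 0 then 1 else cnj (sgn (c i))))"
  have "cmod (l' i) = cmod (l i)" for i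
    by (simp add: l'_def norm_mult norm_sgn)
  then have lp: "lp_norm p n l' = lp_norm p n l" by (simp add: lp_norm_def)
  have "l' i * c i = complex_of_real (cmod (l i) * cmod (c i))" for i
    by (simp add: l'_def sgn_div_norm scaleR_conv_of_real complex_norm_square[symmetric] field_simps power2_eq_square)
  then have "(\<Sum>i=1..n. l' i * c i) = complex_of_real (\<Sum>i=1..n. cmod (l i) * cmod (c i))" by simp
  then have "(\<Sum>i=1..n. cmod (l i) * cmod (c i)) = cmod (\<Sum>i=1..n. l' i * c i)"
    by (simp add: sum_nonneg del: of_real_sum of_real_mult)
  also have "\<dots> \<le> C * lp_norm p n l' * weak_lq_norm (conj_index p) n y"
    using C n x unfolding cohen_inequality_def c_def by blast
  also have "\<dots> \<le> max 0 C * lp_norm p n l * weak_lq_norm (conj_index p) n y"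
    unfolding lp
    by (intro mult_right_mono lp_norm_nonneg n weak_lq_norm_nonneg conj_index_ge_1 p) simp
  finally show "(\<Sum>i=1..n. cmod (l i) * cmod (cdual_apply (y i) (f (x i))))
      \<le> max 0 C * lp_norm p n l * weak_lq_norm (conj_index p) n y"
    by (simp add: c_def)
qed simp

text \<open>
  If the norm were zero, domination would make every functional vanish at \<open>f x\<close>.
\<close>
lemma cohen_norm_pos:
  fixes f :: "'e \<Rightarrow> 'f::complex_normed_vector"
  assumes p: "1 < p" and "cohen_constants p U f \<noteq> {}" and x: "x \<in> U" "f x \<noteq> 0"
  shows "0 < cohen_norm p U f"
proof -
  have mem: "cohen_norm p U f \<in> cohen_constants p U f" using assms(1,2) by (rule cohen_norm_mem)
  then obtain M where "dominated_by p U f (cohen_norm p U f) M"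
    by (rule cohen_constant_imp_dominated[OF p])
  then have dom: "cmod (cdual_apply y (f x)) \<le> cohen_norm p U f * Lq_norm (conj_index p) M y" for y
    using x(1) by (simp add: dominated_by_def)
  obtain y where "cdual_apply y (f x) \<noteq> 0" using cdual_separates_points[OF x(2)] .
  with dom[of y] have "cohen_norm p U f \<noteq> 0" by auto
  moreover have "0 \<le> cohen_norm p U f" using mem by (simp add: cohen_constants_def)
  ultimately show ?thesis by simp
qed

theorem theorem5p2:
  fixes U :: "'e::complex_banach set"
    and f :: "'e \<Rightarrow> 'f::complex_banach"
    and p :: ereal
  assumes "open U" and "1 < p" and "f \<in> H_infinity U"
  shows "(cohen_strongly_summing p U f \<longleftrightarrow>
      (\<forall>(n::nat) (l :: nat \<Rightarrow> complex) (x :: nat \<Rightarrow> 'e) (y :: nat \<Rightarrow> 'f cdual).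
        0 < n \<longrightarrow> (\<forall>i\<in>{1..n}. x i \<in> U) \<longrightarrow>
        cmod (\<Sum>i=1..n. l i * cdual_apply (y i) (f (x i)))
          \<le> cohen_norm p U f * lp_norm p n l * weak_lq_norm (conj_index p) n y))
    \<and> (cohen_strongly_summing p U f \<longleftrightarrow>
      (\<exists>C>0. \<exists>\<mu>. borel_regular_prob bidual_ball \<mu> \<and> dominated_by p U f C \<mu>))
    \<and> (cohen_strongly_summing p U f \<longrightarrow>
      is_minimum (cohen_norm p U f)
        {C. 0 \<le> C \<and> (\<exists>\<mu>. borel_regular_prob bidual_ball \<mu> \<and> dominated_by p U f C \<mu>)}
      \<and> ((\<exists>x\<in>U. f x \<noteq> 0) \<longrightarrow>
        is_minimum (cohen_norm p U f)
          {C. 0 < C \<and> (\<exists>\<mu>. borel_regular_prob bidual_ball \<mu> \<and> dominated_by p U f C \<mu>)}))"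
proof -
  let ?A = "cohen_constants p U f"
  note p = \<open>1 < p\<close>
  have A_eq: "?A = {C. 0 \<le> C \<and> (\<exists>\<mu>. borel_regular_prob bidual_ball \<mu> \<and> dominated_by p U f C \<mu>)}"
    by (rule cohen_constants_eq_dominated[OF p])
  have summing: "cohen_strongly_summing p U f \<longleftrightarrow> ?A \<noteq> {}"
    using assms(3) by (simp add: cohen_strongly_summing_def H_infinity_def)
  have i_ii: "?A \<noteq> {} \<longleftrightarrow> cohen_inequality p U f (cohen_norm p U f)"
    using cohen_norm_mem[OF p] cohen_constant_imp_inequality cohen_inequality_imp_constant[OF p] by blast
  have i_iii: "?A \<noteq> {} \<longleftrightarrow> (\<exists>C>0. \<exists>\<mu>. borel_regular_prob bidual_ball \<mu> \<and> dominated_by p U f C \<mu>)"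
  proof
    assume "?A \<noteq> {}"
    then obtain C \<mu> where C: "0 \<le> C" "borel_regular_prob bidual_ball \<mu>" "dominated_by p U f C \<mu>"
      unfolding A_eq by blast
    have "dominated_by p U f (C + 1) \<mu>"
      unfolding dominated_by_def
    proof (intro ballI allI)
      fix x y assume "x \<in> U"
      then have "cmod (cdual_apply y (f x)) \<le> C * Lq_norm (conj_index p) \<mu> y"
        using C(3) by (simp add: dominated_by_def)
      also have "\<dots> \<le> (C + 1) * Lq_norm (conj_index p) \<mu> y"
        by (intro mult_right_mono Lq_norm_nonneg) simp
      finally show "cmod (cdual_apply y (f x)) \<le> (C + 1) * Lq_norm (conj_index p) \<mu> y" .
    qed
    moreover have "0 < C + 1" using C(1) by simp
    ultimately show "\<exists>C>0. \<exists>\<mu>. borel_regular_prob bidual_ball \<mu> \<and> dominated_by p U f C \<mu>"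
      using C(2) by blast
  next
    assume "\<exists>C>0. \<exists>\<mu>. borel_regular_prob bidual_ball \<mu> \<and> dominated_by p U f C \<mu>"
    then show "?A \<noteq> {}" unfolding A_eq using less_imp_le by blast
  qed
  have min: "is_minimum (cohen_norm p U f) ?A" if "?A \<noteq> {}"
    using cohen_norm_mem[OF p that] cohen_norm_le by (auto simp: is_minimum_def)
  have min_pos: "is_minimum (cohen_norm p U f)
      {C. 0 < C \<and> (\<exists>\<mu>. borel_regular_prob bidual_ball \<mu> \<and> dominated_by p U f C \<mu>)}"
    if "?A \<noteq> {}" "\<exists>x\<in>U. f x \<noteq> 0"
  proof -
    have "0 < cohen_norm p U f" using cohen_norm_pos[OF p that(1)] that(2) by blast
    with min[OF that(1)] show ?thesis
      unfolding A_eq is_minimum_def by (auto intro: less_imp_le)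
  qed
  show ?thesis
  proof (intro conjI impI)
    show "cohen_strongly_summing p U f \<longleftrightarrow>
      (\<forall>(n::nat) (l :: nat \<Rightarrow> complex) (x :: nat \<Rightarrow> 'e) (y :: nat \<Rightarrow> 'f cdual).
        0 < n \<longrightarrow> (\<forall>i\<in>{1..n}. x i \<in> U) \<longrightarrow>
        cmod (\<Sum>i=1..n. l i * cdual_apply (y i) (f (x i)))
          \<le> cohen_norm p U f * lp_norm p n l * weak_lq_norm (conj_index p) n y)"
      unfolding summing i_ii cohen_inequality_def ..
    show "cohen_strongly_summing p U f \<longleftrightarrow>
      (\<exists>C>0. \<exists>\<mu>. borel_regular_prob bidual_ball \<mu> \<and> dominated_by p U f C \<mu>)"
      unfolding summing by (rule i_iii)
  next
    assume "cohen_strongly_summing p U f"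
    then have A: "?A \<noteq> {}" unfolding summing .
    show "is_minimum (cohen_norm p U f)
        {C. 0 \<le> C \<and> (\<exists>\<mu>. borel_regular_prob bidual_ball \<mu> \<and> dominated_by p U f C \<mu>)}"
      using min[OF A] unfolding A_eq .
    show "is_minimum (cohen_norm p U f)
        {C. 0 < C \<and> (\<exists>\<mu>. borel_regular_prob bidual_ball \<mu> \<and> dominated_by p U f C \<mu>)}"
      if "\<exists>x\<in>U. f x \<noteq> 0"
      by (rule min_pos[OF A that])
  qed
qed

end
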